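(* Let $\Delta_G$ be the $4\times4$ matrix $$\Delta_G=\begin{pmatrix}-1&1&0&0\\1&-2&1&0\\0&1&-2&1\\0&0&1&-1\end{pmatrix}$$ (the network is a chain of four elements), and let $f(u)=\Delta_Gu+g(u)$, $g(u)=(g(u_1),\dots,g(u_4))$ for $u\in\mathbb{R}^4$, where $g:\mathbb{R}\to\mathbb{R}$ is an odd $C^1$-function. Assume that $g'(0)=0$, that $|g(u)|>|u|$ for $|u|>M$, and that $f$ satisfies the Nagumo condition: $u\bullet f(u)>0$ whenever $|u|>M$ (for some constant $M>0$). Let $$\omega_1=\sqrt{2-\sqrt2},\qquad \omega_2=\sqrt2,\qquad \omega_3=\sqrt{2+\sqrt2}.$$ Let $p>0$, $\lambda=p/2\pi$, and suppose $\lambda>\frac1{\omega_3}$ is such that $\lambda\neq\frac{k}{\omega_j}$ for all positive odd integers $k$ and $j=1,2,3$. Then the system $$\ddot u(t)=f(u(t)),\qquad u(t)=u(t+p),\quad \dot u(t)=\dot u(t+p),\qquad t\in\mathbb{R},$$ admits a non-constant $p$-periodic solution $u(t)$. Moreover, for any integer $k\geq0$: (a) If $\frac{2k+1}{\omega_1}<\lambda<\frac{2k+3}{\omega_3}$, then there exists a $p$-periodic solution $u(t)$ such that $x(t)=u(\lambda t)$ has isotropy group $\mathbb{Z}_2\times D_{4m+2}^d$ for some $m$. (b) If $\frac{2k+1}{\omega_2}<\lambda<\frac{2k+1}{\omega_1}$, then there exist two $p$-periodic solutions such that the corresponding functions $x(t)=u(\lambda t)$ have isotropy groups $\mathbb{Z}_2\times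 D_{4m+2}^d$ and $V_4^{\mathbb{Z}_2^-}\times_{\mathbb{Z}_2}D_{4m'+2}$, respectively, for some $m,m'$. (c) If $\frac{2k+1}{\omega_3}<\lambda<\frac{2k+1}{\omega_2}$, then there exist two $p$-periodic solutions such that the corresponding functions $x(t)=u(\lambda t)$ have isotropy group $V_4^{\mathbb{Z}_2^-}\times_{\mathbb{Z}_2}D_{4m+2}$ for some $m$. Here $m,m'$ are non-negative integers.
   Context: $\bullet$ and $|\cdot|$ are the Euclidean inner product and norm on $V=\mathbb{R}^4$. The eigenvalues of $\Delta_G$ are $0,-\omega_1^2,-\omega_2^2,-\omega_3^2$. If $u$ is a $p$-periodic solution, then $x(t)=u(\lambda t)$ is a $2\pi$-periodic solution of $\ddot x=\lambda^2f(x)$. Symmetry group: $\Gamma=\mathbb{Z}_2=\{1,\xi\}$ (also written $\{1,-1\}$, with $\xi=-1$) acts on $V$ by $\xi(u_1,u_2,u_3,u_4)=(u_4,u_3,u_2,u_1)$. $G=\Gamma\times\mathbb{Z}_2\times O(2)$, where $O(2)=SO(2)\cup SO(2)\kappa$, $\kappa=\mathrm{diag}(1,-1)$, rotations are written $e^{i\tau}$, acts on $2\pi$-periodic functions $x:\mathbb{R}\to V$ by $$(\gamma,\pm1,e^{i\tau})x(t)=\pm\gamma x(t+\tau),\qquad(\gamma,\pm1,e^{i\tau}\kappa)x(t)=\pm\gamma x(-t+\tau).$$ Isotropy groups are taken with respect to this action: $G_x=\{g\in G: gx=x\}$. For an integer $k\geq1$, put $\zeta=e^{i\pi/k}$. $D_k\leq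 O(2)$ is the dihedral group of order $2k$ generated by $e^{2\pi i/k}$ and $\kappa$. The group $D_{2k}^d\leq\mathbb{Z}_2\times O(2)$ is $$D_{2k}^d=\{((-1)^l,\zeta^l),\ ((-1)^l,\zeta^l\kappa):l=0,1,\dots,2k-1\},$$ and $\mathbb{Z}_2\times D_{2k}^d\leq\Gamma\times(\mathbb{Z}_2\times O(2))$, the first factor being $\Gamma=\mathbb{Z}_2$. With $V_4:=\Gamma\times\mathbb{Z}_2=\mathbb{Z}_2\times\mathbb{Z}_2$, $$V_4^{\mathbb{Z}_2^-}\times_{\mathbb{Z}_2}D_{2k}=\{(g,h)\in V_4\times D_{2k}:\varphi(g)=\psi(h)\},$$ where $\varphi:V_4\to\mathbb{Z}_2$ is the homomorphism with kernel $\mathbb{Z}_2^-:=\{(1,1),(-1,-1)\}$ and $\psi:D_{2k}\to\mathbb{Z}_2$ is the homomorphism with kernel $D_k$. The groups in the claim are those with $2k=4m+2$ (or $4m'+2$). *)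

theory Defs
  imports "HOL-Analysis.Analysis" "HOL-Algebra.Generated_Groups"
begin

section \<open>The network\<close>

definition Delta_G :: "real^4^4" where
  "Delta_G = vector [vector [-1, 1, 0, 0],
                     vector [1, -2, 1, 0],
                     vector [0, 1, -2, 1],
                     vector [0, 0, 1, -1]]"

definition network_field :: "(real \<Rightarrow> real) \<Rightarrow> real^4 \<Rightarrow> real^4" where
  "network_field g u = Delta_G *v u + (\<chi> i. g (u $ i))"

definition omega1 :: real where "omega1 = sqrt (2 - sqrt 2)"
definition omega2 :: real where "omega2 = sqrt 2"
definition omega3 :: real where "omega3 = sqrt (2 + sqrt 2)"

text \<open>
  The number p is a period of u, not necessarily the minimal one; v is the derivative of u.
\<close>
definition periodic_solution :: "(real^4 \<Rightarrow> real^4) \<Rightarrow> real \<Rightarrow> (real \<Rightarrow> real^4) \<Rightarrow> bool" where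
  "periodic_solution f p u \<longleftrightarrow>
     (\<exists>v. (\<forall>t. (u has_vector_derivative v t) (at t))
        \<and> (\<forall>t. (v has_vector_derivative f (u t)) (at t))
        \<and> (\<forall>t. u t = u (t + p))
        \<and> (\<forall>t. v t = v (t + p)))"

section \<open>The symmetry group and its action\<close>

definition Z2 :: "int set" where "Z2 = {1, -1}"

definition O2 :: "(real^2^2) monoid" where
  "O2 = \<lparr>carrier = {A. orthogonal_matrix A}, mult = (**), one = mat 1\<rparr>"

definition rot :: "real \<Rightarrow> real^2^2" where
  "rot \<tau> = vector [vector [cos \<tau>, - sin \<tau>], vector [sin \<tau>, cos \<tau>]]"

definition kappa :: "real^2^2" where
  "kappa = vector [vector [1, 0], vector [0, -1]]"

definition xi :: "real^4 \<Rightarrow> real^4" where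
  "xi u = vector [u $ 4, u $ 3, u $ 2, u $ 1]"

text \<open>
  The group is \<open>\<Gamma> \<times> (Z2 \<times> O(2))\<close>, where \<open>\<Gamma> = {1, -1}\<close> with \<open>-1\<close> standing for \<open>\<xi>\<close>.
\<close>
definition G_carrier :: "(int \<times> int \<times> (real^2^2)) set" where
  "G_carrier = Z2 \<times> Z2 \<times> carrier O2"

definition Gamma_act :: "int \<Rightarrow> real^4 \<Rightarrow> real^4" where
  "Gamma_act \<gamma> u = (if \<gamma> = 1 then u else xi u)"

text \<open>
  Both \<open>rot \<tau>\<close> and \<open>rot \<tau> ** kappa\<close> have first column \<open>(cos \<tau>, sin \<tau>)\<close>, so the first column of
  an orthogonal matrix determines \<open>\<tau>\<close> up to multiples of \<open>2\<pi>\<close>; the determinant tells the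
  two cases apart. The choice of \<open>\<tau>\<close> is irrelevant on \<open>2\<pi>\<close>-periodic functions: see
  \<open>act_rot\<close> and \<open>act_rot_kappa\<close> below.
\<close>
definition angle :: "real^2^2 \<Rightarrow> real" where
  "angle A = Arg (Complex (A $ 1 $ 1) (A $ 2 $ 1))"

definition act :: "int \<times> int \<times> (real^2^2) \<Rightarrow> (real \<Rightarrow> real^4) \<Rightarrow> real \<Rightarrow> real^4" where
  "act = (\<lambda>(\<gamma>, s, A) x t.
     of_int s *\<^sub>R Gamma_act \<gamma> (x (if det A = 1 then t + angle A else - t + angle A)))"

definition isotropy_group :: "(real \<Rightarrow> real^4) \<Rightarrow> (int \<times> int \<times> (real^2^2)) set" where
  "isotropy_group x = {h \<in> G_carrier. act h x = x}"

text \<open>Rescaling of time: for p-periodic u, with \<open>r = p / 2\<pi>\<close>, this is \<open>2\<pi>\<close>-periodic.\<close>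
definition rescale :: "real \<Rightarrow> (real \<Rightarrow> real^4) \<Rightarrow> real \<Rightarrow> real^4" where
  "rescale r u = (\<lambda>t. u (r * t))"

section \<open>The isotropy groups\<close>

definition dihedral :: "nat \<Rightarrow> (real^2^2) set" where
  "dihedral k = generate O2 {rot (2 * pi / real k), kappa}"

text \<open>
  The definitions below take k as parameter and describe \<open>D\<^sub>2\<^sub>k\<^sup>d\<close>, \<open>Z2 \<times> D\<^sub>2\<^sub>k\<^sup>d\<close> and
  the amalgamated product with \<open>D\<^sub>2\<^sub>k\<close>; thus \<open>D\<^sub>4\<^sub>m\<^sub>+\<^sub>2\<^sup>d\<close> is \<open>dihedral_d (2 * m + 1)\<close>.
\<close>
definition dihedral_d :: "nat \<Rightarrow> (int \<times> (real^2^2)) set" where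
  "dihedral_d k =
     {((-1) ^ l, rot (real l * (pi / real k))) | l. l < 2 * k} \<union>
     {((-1) ^ l, rot (real l * (pi / real k)) ** kappa) | l. l < 2 * k}"

definition Z2_times_dihedral_d :: "nat \<Rightarrow> (int \<times> int \<times> (real^2^2)) set" where
  "Z2_times_dihedral_d k = Z2 \<times> dihedral_d k"

definition V4 :: "(int \<times> int) set" where "V4 = Z2 \<times> Z2"

definition Z2_minus :: "(int \<times> int) set" where "Z2_minus = {(1, 1), (-1, -1)}"

text \<open>
  A homomorphism to a group of order two is determined by its kernel. That \<open>phi\<close> and
  \<open>psi k\<close> are homomorphisms on \<open>V4\<close> and \<open>D\<^sub>2\<^sub>k\<close> is proved below.
\<close>
definition phi :: "int \<times> int \<Rightarrow> int" where
  "phi g = (if g \<in> Z2_minus then 1 else -1)"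

definition psi :: "nat \<Rightarrow> real^2^2 \<Rightarrow> int" where
  "psi k h = (if h \<in> dihedral k then 1 else -1)"

definition V4_amalgam_dihedral :: "nat \<Rightarrow> (int \<times> int \<times> (real^2^2)) set" where
  "V4_amalgam_dihedral k =
     {(\<gamma>, s, h). (\<gamma>, s) \<in> V4 \<and> h \<in> dihedral (2 * k) \<and> phi (\<gamma>, s) = psi k h}"

section \<open>Consistency of the encoding\<close>

lemma mat2_eq_iff:
  "(A :: real^2^2) = B \<longleftrightarrow>
     A$1$1 = B$1$1 \<and> A$1$2 = B$1$2 \<and> A$2$1 = B$2$1 \<and> A$2$2 = B$2$2"
  by (auto simp: vec_eq_iff forall_2)

lemmas mat2_simps = mat2_eq_iff matrix_matrix_mult_def sum_2 rot_def kappa_def mat_def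
  transpose_def

lemma rot_mult: "rot a ** rot b = rot (a + b)"
  by (simp add: mat2_simps cos_add sin_add algebra_simps)

lemma kappa_rot: "kappa ** rot a = rot (- a) ** kappa"
  by (simp add: mat2_simps)

lemma kappa_kappa: "kappa ** kappa = mat 1"
  by (simp add: mat2_simps)

lemma rot_0: "rot 0 = mat 1"
  by (simp add: mat2_simps)

lemma rot_eq_iff: "rot a = rot b \<longleftrightarrow> (\<exists>n::int. a = b + 2 * pi * of_int n)"
proof -
  have "rot a = rot b \<longleftrightarrow> sin a = sin b \<and> cos a = cos b"
    by (auto simp: mat2_simps)
  then show ?thesis by (simp add: sin_cos_eq_iff algebra_simps)
qed

lemma det_rot: "det (rot a) = 1"
  by (simp add: det_2 rot_def flip: power2_eq_square)

lemma det_rot_kappa: "det (rot a ** kappa) = -1"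
  by (simp add: det_mul det_rot) (simp add: det_2 kappa_def)

lemma orthogonal_rot: "orthogonal_matrix (rot a)"
  by (simp add: orthogonal_matrix mat2_simps flip: power2_eq_square)

lemma orthogonal_kappa: "orthogonal_matrix kappa"
  by (simp add: orthogonal_matrix mat2_simps)

lemma angle_rot: "\<exists>n::int. angle (rot a) = a + 2 * pi * of_int n"
proof -
  have "Complex (rot a $ 1 $ 1) (rot a $ 2 $ 1) = cis a"
    by (simp add: rot_def complex_eq_iff)
  moreover have "cis (Arg (cis a)) = cis a"
    by (simp add: cis_Arg sgn_div_norm)
  ultimately have "cis (angle (rot a)) = cis a" by (simp add: angle_def)
  then have "sin (angle (rot a)) = sin a \<and> cos (angle (rot a)) = cos a"
    by (simp add: complex_eq_iff)
  then show ?thesis by (simp add: sin_cos_eq_iff algebra_simps)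
qed

lemma angle_rot_kappa: "angle (rot a ** kappa) = angle (rot a)"
  by (simp add: angle_def mat2_simps)

lemma periodic_int:
  fixes x :: "real \<Rightarrow> 'a"
  assumes per: "\<And>t. x (t + 2 * pi) = x t"
  shows "x (t + 2 * pi * of_int n) = x t"
proof (induction n rule: int_induct[where k = 0])
  case base
  show ?case by simp
next
  case (step1 i)
  then show ?case using per[of "t + 2 * pi * of_int i"] by (simp add: algebra_simps)
next
  case (step2 i)
  then show ?case using per[of "t + 2 * pi * of_int (i - 1)"] by (simp add: algebra_simps)
qed

lemma act_rot:
  assumes "\<And>t. x (t + 2 * pi) = x t"
  shows "act (\<gamma>, s, rot \<tau>) x t = of_int s *\<^sub>R Gamma_act \<gamma> (x (t + \<tau>))"
proof -
  obtain n :: int where "angle (rot \<tau>) = \<tau> + 2 * pi * of_int n" using angle_rot by blast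
  then show ?thesis using periodic_int[of x "t + \<tau>" n, OF assms]
    by (simp add: act_def det_rot add.assoc)
qed

lemma act_rot_kappa:
  assumes "\<And>t. x (t + 2 * pi) = x t"
  shows "act (\<gamma>, s, rot \<tau> ** kappa) x t = of_int s *\<^sub>R Gamma_act \<gamma> (x (- t + \<tau>))"
proof -
  obtain n :: int where "angle (rot \<tau>) = \<tau> + 2 * pi * of_int n" using angle_rot by blast
  then show ?thesis using periodic_int[of x "- t + \<tau>" n, OF assms]
    by (simp add: act_def det_rot_kappa angle_rot_kappa algebra_simps)
qed

lemma group_O2: "group O2"
proof (rule groupI)
  fix A assume "A \<in> carrier O2"
  then show "\<exists>B\<in>carrier O2. B \<otimes>\<^bsub>O2\<^esub> A = \<one>\<^bsub>O2\<^esub>"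
    by (intro bexI[of _ "transpose A"]) (auto simp: O2_def orthogonal_matrix_def)
qed (auto simp: O2_def orthogonal_matrix_mul orthogonal_matrix_id matrix_mul_assoc)

lemma inv_O2: "A \<in> carrier O2 \<Longrightarrow> inv\<^bsub>O2\<^esub> A = transpose A"
  by (rule group.inv_equality[OF group_O2]) (auto simp: O2_def orthogonal_matrix_def)

lemma dihedral_eq:
  "dihedral k = range (\<lambda>n::int. rot (of_int n * (2 * pi / real k))) \<union>
                range (\<lambda>n::int. rot (of_int n * (2 * pi / real k)) ** kappa)"
    (is "_ = range ?R \<union> range ?S")
proof
  have RR: "?R m ** ?R n = ?R (m + n)" for m n
    by (simp only: rot_mult of_int_add distrib_right)
  have RS: "?R m ** ?S n = ?S (m + n)" for m n
    by (simp only: matrix_mul_assoc RR)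
  have SR: "?S m ** ?R n = ?S (m - n)" for m n
  proof -
    have "?S m ** ?R n = ?R m ** (kappa ** ?R n)" by (simp only: matrix_mul_assoc)
    also have "\<dots> = ?R m ** ?S (- n)" by (simp add: kappa_rot)
    finally show ?thesis by (simp only: RS) simp
  qed
  have SS: "?S m ** ?S n = ?R (m - n)" for m n
  proof -
    have "?S m ** ?S n = (?S m ** ?R n) ** kappa" by (simp only: matrix_mul_assoc)
    also have "\<dots> = ?R (m - n) ** (kappa ** kappa)" by (simp only: SR matrix_mul_assoc)
    finally show ?thesis by (simp add: kappa_kappa)
  qed
  have R1: "rot (2 * pi / real k) = ?R 1" and S0: "kappa = ?S 0"
    by (simp_all add: rot_0)
  show "dihedral k \<subseteq> range ?R \<union> range ?S"
  proof
    fix A assume "A \<in> dihedral k"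
    then have "A \<in> generate O2 {rot (2 * pi / real k), kappa}" by (simp add: dihedral_def)
    then show "A \<in> range ?R \<union> range ?S"
    proof induction
      case one
      have "mat 1 = ?R 0" by (simp add: rot_0)
      then have "mat 1 \<in> range ?R" by (rule range_eqI)
      then show ?case by (simp add: O2_def)
    next
      case (incl h)
      then show ?case using R1 S0 by blast
    next
      case (inv h)
      have "transpose (rot (2 * pi / real k)) = ?R (-1)" "transpose kappa = kappa"
        by (simp_all add: mat2_simps)
      moreover have "h \<in> carrier O2"
        using inv orthogonal_rot orthogonal_kappa by (auto simp: O2_def)
      ultimately have "inv\<^bsub>O2\<^esub> h = ?R (-1) \<or> inv\<^bsub>O2\<^esub> h = ?S 0"
        using inv S0 inv_O2[of h] by auto
      then show ?case by blast
    next
      case (eng h1 h2)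
      from eng.IH obtain m n where
        "(h1 = ?R m \<or> h1 = ?S m) \<and> (h2 = ?R n \<or> h2 = ?S n)" by blast
      then have "h1 ** h2 \<in> {?R (m + n), ?S (m + n), ?S (m - n), ?R (m - n)}"
        using RR[of m n] RS[of m n] SR[of m n] SS[of m n] by (elim conjE disjE) (simp_all only: insert_iff simp_thms)
      then have "h1 ** h2 \<in> range ?R \<union> range ?S" by blast
      then show ?case by (simp add: O2_def)
    qed
  qed
  have gen: "A ** B \<in> dihedral k" if "A \<in> dihedral k" "B \<in> dihedral k" for A B
    using generate.eng[of A O2 _ B] that by (auto simp: dihedral_def O2_def)
  have K: "kappa \<in> dihedral k" and P: "?R 1 \<in> dihedral k"
    by (auto simp: dihedral_def intro: generate.incl)
  have "transpose (?R 1) \<in> dihedral k"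
    using generate.inv[of "rot (2 * pi / real k)" _ O2] inv_O2[of "rot (2 * pi / real k)"]
      orthogonal_rot by (auto simp: dihedral_def O2_def)
  moreover have "transpose (?R 1) = ?R (-1)" by (simp add: mat2_simps)
  ultimately have N: "?R (-1) \<in> dihedral k" by simp
  have Z: "?R 0 \<in> dihedral k"
    using generate.one[of O2] by (auto simp: dihedral_def O2_def rot_0)
  have R: "?R n \<in> dihedral k" for n
  proof (induction n rule: int_induct[where k = 0])
    case base
    show ?case using Z .
  next
    case (step1 i)
    then show ?case using gen[OF _ P] RR[of i 1] by metis
  next
    case (step2 i)
    have "?R i ** ?R (-1) = ?R (i - 1)" using RR[of i "-1"] by simp
    then show ?case using gen[OF step2.IH N] by metis
  qed
  then show "range ?R \<union> range ?S \<subseteq> dihedral k" using gen[OF _ K] by blast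
qed

lemma phi_hom:
  assumes "(a, b) \<in> V4" "(c, d) \<in> V4"
  shows "phi (a * c, b * d) = phi (a, b) * phi (c, d)"
  using assms by (auto simp: V4_def Z2_def phi_def Z2_minus_def)

lemma phi_kernel: "{g \<in> V4. phi g = 1} = Z2_minus"
  by (auto simp: V4_def Z2_def phi_def Z2_minus_def)

lemma rot_neq_rot_kappa: "rot a \<noteq> rot b ** kappa"
  using det_rot[of a] det_rot_kappa[of b] by auto

lemma kappa_cancel: "A ** kappa = B ** kappa \<longleftrightarrow> A = B"
  by (metis kappa_kappa matrix_mul_assoc matrix_mul_rid)

lemma rot_in_dihedral:
  assumes "k \<ge> 1"
  shows "rot (of_int n * (2 * pi / real (2 * k))) \<in> dihedral k \<longleftrightarrow> even n"
proof -
  have "rot (of_int n * (2 * pi / real (2 * k))) \<in> dihedral k \<longleftrightarrow>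
      (\<exists>m j::int. of_int n * (2 * pi / real (2 * k)) =
         of_int m * (2 * pi / real k) + 2 * pi * of_int j)"
    by (auto simp: dihedral_eq rot_neq_rot_kappa image_iff rot_eq_iff)
  also have "\<dots> \<longleftrightarrow> (\<exists>m j::int. n = 2 * m + 2 * int k * j)"
  proof -
    have "of_int n * (2 * pi / real (2 * k)) = of_int m * (2 * pi / real k) + 2 * pi * of_int j
        \<longleftrightarrow> real_of_int n = real_of_int (2 * m + 2 * int k * j)" for m j :: int
      using assms by (simp add: field_simps) (simp flip: distrib_left add: mult.assoc)
    then show ?thesis by (simp only: of_int_eq_iff)
  qed
  also have "\<dots> \<longleftrightarrow> even n"
  proof
    assume "even n"
    then obtain b where "n = 2 * b" by (elim evenE)
    then have "n = 2 * b + 2 * int k * 0" by simp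
    then show "\<exists>m j::int. n = 2 * m + 2 * int k * j" by blast
  qed auto
  finally show ?thesis .
qed

lemma rot_kappa_in_dihedral: "rot a ** kappa \<in> dihedral k \<longleftrightarrow> rot a \<in> dihedral k"
  by (auto simp: dihedral_eq image_iff kappa_cancel rot_neq_rot_kappa rot_neq_rot_kappa[symmetric])

lemma psi_hom:
  assumes k: "k \<ge> 1" and A: "A \<in> dihedral (2 * k)" and B: "B \<in> dihedral (2 * k)"
  shows "psi k (A ** B) = psi k A * psi k B"
proof -
  define R where "R n = rot (of_int n * (2 * pi / real (2 * k)))" for n :: int
  have RR: "R m ** R n = R (m + n)" for m n
    by (simp only: R_def rot_mult of_int_add distrib_right)
  have KR: "kappa ** R n = R (- n) ** kappa" for n by (simp add: R_def kappa_rot)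
  have psiR: "psi k (R n) = (if even n then 1 else -1)"
    and psiS: "psi k (R n ** kappa) = (if even n then 1 else -1)" for n
    using rot_in_dihedral[OF k, of n]
    by (simp_all add: psi_def R_def rot_kappa_in_dihedral)
  have RS: "R m ** (R n ** kappa) = R (m + n) ** kappa" for m n
    by (simp only: matrix_mul_assoc RR)
  have SR: "(R m ** kappa) ** R n = R (m - n) ** kappa" for m n
    using RS[of m "-n"] KR[of n] by (simp flip: matrix_mul_assoc)
  have SS: "(R m ** kappa) ** (R n ** kappa) = R (m - n)" for m n
  proof -
    have "(R m ** kappa) ** (R n ** kappa) = ((R m ** kappa) ** R n) ** kappa"
      by (simp only: matrix_mul_assoc)
    also have "\<dots> = R (m - n) ** (kappa ** kappa)" by (simp only: SR matrix_mul_assoc)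
    finally show ?thesis by (simp add: kappa_kappa)
  qed
  have "A \<in> range R \<union> range (\<lambda>n. R n ** kappa)" "B \<in> range R \<union> range (\<lambda>n. R n ** kappa)"
    using A B unfolding dihedral_eq R_def by auto
  then show ?thesis
    by (elim UnE imageE; simp only: RR RS SR SS psiR psiS) auto
qed

lemma psi_kernel:
  assumes "k \<ge> 1"
  shows "{h \<in> dihedral (2 * k). psi k h = 1} = dihedral k"
proof -
  have "rot (of_int n * (2 * pi / real k)) \<in> dihedral (2 * k)" for n :: int
  proof -
    have "of_int n * (2 * pi / real k) = of_int (2 * n) * (2 * pi / real (2 * k))"
      using assms by (simp add: field_simps)
    then show ?thesis unfolding dihedral_eq by (metis UnI1 rangeI)
  qed
  then have "dihedral k \<subseteq> dihedral (2 * k)"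
    using rot_kappa_in_dihedral unfolding dihedral_eq[of k] by blast
  then show ?thesis by (auto simp: psi_def)
qed

end

theory Submission
  imports Defs "HOL-Complex_Analysis.Great_Picard"
begin

text \<open>
  The rescaled equation $x'' = \lambda^2 f(x)$ is the Euler--Lagrange equation of
  $\Phi(x) = \int \frac12 |x'|^2 + F(x)$ with $\nabla F = \lambda^2 f$, so no degree theory is
  needed: in the class of even, $\pi$-antiperiodic functions with values in one of the two
  eigenspaces of $\xi$, a solution arises by decreasing $\Phi$ from a negative value.
  For large $c$ the function $H(u) = \frac c2 |u|^2 - F(u)$ is convex on a large ball, hence the
  step $x \mapsto z$ given by $-z'' + c z = \nabla H(x)$ decreases $\Phi$ by at least
  $\frac c2 \|z - x\|^2$, and by the Nagumo condition it preserves the ball (maximum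
  principle). Arzela--Ascoli yields a fixed point in the limit, which solves the equation. It is
  not zero, because $\Phi(\varepsilon \cos t\, v) < 0$ for small $\varepsilon$ whenever $v$ is an
  eigenvector for $-\omega^2$ and $\lambda\omega > 1$; for $\omega_2$ and $\omega_3$ there are such
  $v$ in the symmetric and in the antisymmetric eigenspace.

  The numbers $\tau$ with $x(t + \tau) = \pm x(t)$ form a discrete group containing
  $\pi$ with sign $-1$, so it is generated by $\pi / (2m+1)$ with sign $-1$; this
  determines the isotropy group. In part (c) the second solution is the negative of the first.
\<close>

section \<open>Waves and the linear problem\<close>

lemma eq_minus_self_iff: "v = - v \<longleftrightarrow> v = 0" for v :: "'a::real_vector"
  by (simp add: eq_neg_iff_add_eq_0 flip: scaleR_2)

text \<open>If \<open>d\<close> were positive, \<open>q'\<close>, which vanishes at the maximum,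
  would be positive just to the right of \<open>t0\<close>, and the mean value theorem would give a
  value above \<open>q t0\<close>.\<close>

lemma second_derivative_at_max:
  fixes q :: "real \<Rightarrow> real"
  assumes q: "\<And>t. (q has_real_derivative q' t) (at t)"
    and q': "(q' has_real_derivative d) (at t0)"
    and max: "\<And>t. q t \<le> q t0"
  shows "d \<le> 0"
proof (rule ccontr)
  assume "\<not> d \<le> 0"
  then have d: "d > 0" by simp
  have z: "q' t0 = 0"
    by (rule DERIV_local_max[OF q, of 1 t0]) (auto intro: max)
  obtain e where e: "e > 0" "\<And>h. 0 < h \<Longrightarrow> h < e \<Longrightarrow> q' t0 < q' (t0 + h)"
    using DERIV_pos_inc_right[OF q' d] by blast
  obtain s where s: "t0 < s" "s < t0 + e / 2" "q (t0 + e / 2) - q t0 = (t0 + e / 2 - t0) * q' s"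
    using MVT2[of t0 "t0 + e / 2" q q'] q e(1) by auto
  have "q' s > 0" using e(2)[of "s - t0"] s e(1) z by simp
  then have "(t0 + e / 2 - t0) * q' s > 0" using e(1) by simp
  then show False using s(3) max[of "t0 + e / 2"] by linarith
qed

lemma has_vector_derivative_inner:
  fixes x y :: "real \<Rightarrow> 'a::real_inner"
  assumes "(x has_vector_derivative x') (at t)" "(y has_vector_derivative y') (at t)"
  shows "((\<lambda>t. x t \<bullet> y t) has_real_derivative (x t \<bullet> y' + x' \<bullet> y t)) (at t)"
  using bounded_bilinear.has_vector_derivative[OF bounded_bilinear_inner assms]
  by (simp add: has_real_derivative_iff_has_vector_derivative)

text \<open>The fixed space of time reversal, of the half-period shift with a change of sign, and of
  \<open>P\<close>, which is later \<open>xi\<close> or its negative. Evenness makes the derivative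
  vanish at 0, and antiperiodicity leaves zero as the only constant curve.\<close>

definition wave :: "('a::euclidean_space \<Rightarrow> 'a) \<Rightarrow> (real \<Rightarrow> 'a) \<Rightarrow> bool" where
  "wave P x \<longleftrightarrow> (\<forall>t. x (- t) = x t) \<and> (\<forall>t. x (t + pi) = - x t) \<and> (\<forall>t. P (x t) = x t)"

text \<open>First-order form of -x'' + c x = q. The derivative \<open>y\<close> is an argument, so
  that limits of derivatives can be taken together with limits of curves.\<close>

definition linear_solution ::
    "real \<Rightarrow> (real \<Rightarrow> 'a::euclidean_space) \<Rightarrow> (real \<Rightarrow> 'a) \<Rightarrow> (real \<Rightarrow> 'a) \<Rightarrow> bool" where
  "linear_solution c x y q \<longleftrightarrow>
     (\<forall>t. (x has_vector_derivative y t) (at t)) \<and>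
     (\<forall>t. (y has_vector_derivative c *\<^sub>R x t - q t) (at t))"

lemma linear_solution_diff:
  assumes "linear_solution c x1 y1 q1" "linear_solution c x2 y2 q2"
  shows "linear_solution c (\<lambda>t. x1 t - x2 t) (\<lambda>t. y1 t - y2 t) (\<lambda>t. q1 t - q2 t)"
  using assms unfolding linear_solution_def
  by (auto intro!: derivative_eq_intros simp: algebra_simps)

lemma linear_solution_continuous:
  assumes "linear_solution c x y q"
  shows "continuous_on S x" "continuous_on S y"
  using assms unfolding linear_solution_def
  by (meson continuous_at_imp_continuous_on has_vector_derivative_continuous)+

text \<open>The operator factors as (D + m)(D - m) with m^2 = c: first y - m w, then w itself solves
  a first-order equation, and the matching exponential factor makes it constant.\<close>

lemma linear_ivp_unique:
  fixes w :: "real \<Rightarrow> 'a::euclidean_space"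
  assumes c: "c > 0" and sol: "linear_solution c w y (\<lambda>_. 0)" and init: "w a = 0" "y a = 0"
  shows "w t = 0"
proof -
  define m where "m = sqrt c"
  have mm: "m * m = c" using c by (simp add: m_def)
  have w: "(w has_vector_derivative y s) (at s)" and y: "(y has_vector_derivative c *\<^sub>R w s) (at s)" for s
    using sol by (auto simp: linear_solution_def)
  have const: "\<exists>b. \<forall>s. h s = b" if d0: "\<And>s. (h has_vector_derivative 0) (at s)" for h :: "real \<Rightarrow> 'a"
  proof -
    obtain b where "\<And>s. h s = b"
      by (rule has_vector_derivative_zero_constant[of UNIV h]) (use d0 in auto)
    then show ?thesis by blast
  qed
  have "((\<lambda>s. exp (m * s) *\<^sub>R (y s - m *\<^sub>R w s)) has_vector_derivative 0) (at s)" for s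
    by (rule derivative_eq_intros w y refl | simp)+
       (simp add: algebra_simps mm[symmetric])
  then obtain b where b: "\<forall>s. exp (m * s) *\<^sub>R (y s - m *\<^sub>R w s) = b"
    using const[of "\<lambda>s. exp (m * s) *\<^sub>R (y s - m *\<^sub>R w s)"] by blast
  from b[rule_format, of a] init have "b = 0" by simp
  with b have ym: "y s = m *\<^sub>R w s" for s by simp
  have "((\<lambda>s. exp (- m * s) *\<^sub>R w s) has_vector_derivative 0) (at s)" for s
    by (rule derivative_eq_intros w refl | simp)+ (simp add: ym algebra_simps)
  then obtain b where b: "\<forall>s. exp (- m * s) *\<^sub>R w s = b"
    using const[of "\<lambda>s. exp (- m * s) *\<^sub>R w s"] by blast
  from b[rule_format, of a] init have "b = 0" by simp
  with b show ?thesis by simp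
qed

section \<open>Periodicity and the energy identity\<close>

lemma wave_periodic:
  assumes "wave P x"
  shows "x (t + 2 * pi) = x t"
  using assms unfolding wave_def by (metis add.assoc minus_minus mult_2)

lemma periodic_reduce:
  fixes x :: "real \<Rightarrow> 'a"
  assumes "\<And>t. x (t + 2 * pi) = x t"
  shows "x t = x (2 * pi * frac (t / (2 * pi)))"
  using periodic_int[of x "2 * pi * frac (t / (2 * pi))" "\<lfloor>t / (2 * pi)\<rfloor>", OF assms]
  by (simp add: frac_def algebra_simps)

lemma periodic_reduce_range: "2 * pi * frac (t / (2 * pi)) \<in> {0..2 * pi}"
  using frac_lt_1[of "t / (2 * pi)"] by (simp add: less_imp_le)

lemma linear_solution_deriv_periodic:
  assumes "linear_solution c x y q" "wave P x"
  shows "y (t + 2 * pi) = y t"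
proof -
  have x: "(x has_vector_derivative y s) (at s)" for s
    using assms by (auto simp: linear_solution_def)
  have "((x \<circ> (\<lambda>t. t + 2 * pi)) has_vector_derivative 1 *\<^sub>R y (t + 2 * pi)) (at t)"
    by (rule vector_diff_chain_at[OF _ x]) (auto intro!: derivative_eq_intros)
  moreover have "x \<circ> (\<lambda>t. t + 2 * pi) = x" using wave_periodic[OF assms(2)] by auto
  ultimately show ?thesis using x[of t] vector_derivative_unique_at by fastforce
qed

lemma linear_solution_deriv_0:
  assumes "linear_solution c x y q" "wave P x"
  shows "y 0 = 0"
proof -
  have x: "(x has_vector_derivative y s) (at s)" for s
    using assms by (auto simp: linear_solution_def)
  have "((x \<circ> uminus) has_vector_derivative (-1) *\<^sub>R y (- 0)) (at 0)"
    by (rule vector_diff_chain_at[OF _ x]) (auto intro!: derivative_eq_intros)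
  moreover have "x \<circ> uminus = x" using assms by (auto simp: wave_def)
  ultimately have "y 0 = - y 0" using x[of 0] vector_derivative_unique_at by fastforce
  then show ?thesis by (simp add: eq_minus_self_iff)
qed

text \<open>The integrand is the derivative of \<open>y1 t \<bullet> x2 t\<close>, whose values at
  the two ends of a period agree. This is the equation of \<open>x1\<close> tested against
  \<open>x2\<close>.\<close>

lemma linear_solution_energy:
  fixes x1 x2 :: "real \<Rightarrow> 'a::euclidean_space"
  assumes 1: "linear_solution c x1 y1 q1" "wave P x1" and 2: "linear_solution c x2 y2 q2" "wave P x2"
  shows "((\<lambda>t. y1 t \<bullet> y2 t + c * (x1 t \<bullet> x2 t) - q1 t \<bullet> x2 t) has_integral 0) {0..2 * pi}"
proof -
  have d: "((\<lambda>t. y1 t \<bullet> x2 t) has_real_derivative (y1 t \<bullet> y2 t + (c *\<^sub>R x1 t - q1 t) \<bullet> x2 t)) (at t)" for t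
    using 1 2 unfolding linear_solution_def by (intro has_vector_derivative_inner) auto
  have "((\<lambda>t. y1 t \<bullet> y2 t + (c *\<^sub>R x1 t - q1 t) \<bullet> x2 t) has_integral
      (y1 (2 * pi) \<bullet> x2 (2 * pi) - y1 0 \<bullet> x2 0)) {0..2 * pi}"
    by (rule fundamental_theorem_of_calculus)
      (auto intro!: has_vector_derivative_at_within d[unfolded has_real_derivative_iff_has_vector_derivative])
  moreover have "y1 (2 * pi) = y1 0" "x2 (2 * pi) = x2 0"
    using linear_solution_deriv_periodic[OF 1, of 0] wave_periodic[OF 2(2), of 0] by auto
  ultimately show ?thesis by (simp add: inner_diff_left algebra_simps)
qed

section \<open>Solvability of the linear problem\<close>

lemma antiderivative_exists:
  fixes h :: "real \<Rightarrow> 'a::euclidean_space"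
  assumes "continuous_on UNIV h"
  shows "\<exists>H. (\<forall>t. (H has_vector_derivative h t) (at t)) \<and> H 0 = 0"
proof -
  have "\<exists>H. \<forall>t. - \<infinity> < ereal t \<longrightarrow> ereal t < \<infinity> \<longrightarrow> (H has_vector_derivative h t) (at t)"
    by (rule einterval_antiderivative) (use assms in \<open>auto simp: continuous_on_eq_continuous_at\<close>)
  then obtain H where "\<And>t. (H has_vector_derivative h t) (at t)" by auto
  then have "(\<forall>t. ((\<lambda>t. H t - H 0) has_vector_derivative h t) (at t)) \<and> H 0 - H 0 = 0"
    by (auto intro!: derivative_eq_intros)
  then show ?thesis by blast
qed

text \<open>Variation of constants solves the equation with derivative zero at 0 and value zero at
  pi/2. The symmetries in time then follow from uniqueness for initial values, the one under
  \<open>P\<close> from the energy identity.\<close>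

lemma linear_solution_exists:
  fixes q :: "real \<Rightarrow> 'a::euclidean_space"
  assumes c: "c > 0" and cont: "continuous_on UNIV q" and q: "wave P q" and P: "bounded_linear P"
  shows "\<exists>x y. linear_solution c x y q \<and> wave P x"
proof -
  define m where "m = sqrt c"
  have m: "m > 0" and mm: "m * m = c" using c by (simp_all add: m_def)
  have "continuous_on UNIV (\<lambda>t. cosh (m * t) *\<^sub>R q t)" "continuous_on UNIV (\<lambda>t. sinh (m * t) *\<^sub>R q t)"
    by (intro continuous_intros cont)+
  from this[THEN antiderivative_exists] obtain H1 H2
    where H1: "\<And>t. (H1 has_vector_derivative cosh (m * t) *\<^sub>R q t) (at t)" "H1 0 = 0"
      and H2: "\<And>t. (H2 has_vector_derivative sinh (m * t) *\<^sub>R q t) (at t)"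
    by blast
  \<comment> \<open>A particular solution that vanishes together with its derivative at 0. The
    multiple of cosh added below keeps the derivative at 0, and \<open>A\<close> makes the sum
    vanish at pi/2.\<close>
  define z where "z t = (1 / m) *\<^sub>R (cosh (m * t) *\<^sub>R H2 t - sinh (m * t) *\<^sub>R H1 t)" for t
  define A where "A = - (1 / cosh (m * (pi / 2))) *\<^sub>R z (pi / 2)"
  define x where "x t = z t + cosh (m * t) *\<^sub>R A" for t
  define y where "y t = sinh (m * t) *\<^sub>R H2 t - cosh (m * t) *\<^sub>R H1 t + (m * sinh (m * t)) *\<^sub>R A" for t
  have x: "(x has_vector_derivative y t) (at t)" for t
    unfolding x_def z_def y_def
    by (rule derivative_eq_intros H1 H2 refl | simp)+ (use m in \<open>simp add: algebra_simps\<close>)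
  have y: "(y has_vector_derivative c *\<^sub>R x t - q t) (at t)" for t
  proof -
    have "cosh (m * t) * cosh (m * t) = 1 + sinh (m * t) * sinh (m * t)"
      using hyperbolic_pythagoras[of "m * t"] by (simp add: power2_eq_square)
    then have "(cosh (m * t) * cosh (m * t)) *\<^sub>R q t = q t + (sinh (m * t) * sinh (m * t)) *\<^sub>R q t"
      by (simp only: scaleR_left_distrib scaleR_one)
    then show ?thesis
      unfolding x_def z_def y_def mm[symmetric]
      by - ((rule derivative_eq_intros H1 H2 refl | simp)+, use m in \<open>simp add: algebra_simps\<close>)
  qed
  have sol: "linear_solution c x y q" using x y by (simp add: linear_solution_def)
  have x_half: "x (pi / 2) = 0" by (simp add: x_def A_def)
  have y0: "y 0 = 0" by (simp add: y_def H1)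
  have reflected: "((\<lambda>t. h (b - t)) has_vector_derivative - h') (at t)"
    if "(h has_vector_derivative h') (at (b - t))" for h :: "real \<Rightarrow> 'a" and h' b t
  proof -
    have "((h \<circ> (\<lambda>t. b - t)) has_vector_derivative (-1) *\<^sub>R h') (at t)"
      by (rule vector_diff_chain_at[where g = h and f = "\<lambda>t. b - t", OF _ that]) (auto intro!: derivative_eq_intros)
    then show ?thesis by (simp add: o_def)
  qed
  have q_even: "q (- t) = q t" and q_anti: "q (t + pi) = - q t" and qP: "P (q t) = q t" for t
    using q by (auto simp: wave_def)
  have q_refl: "q (pi - t) = - q t" for t using q_anti[of "- t"] q_even by simp
  have even: "x (- t) = x t" for t
  proof -
    have "linear_solution c (\<lambda>t. x (0 - t)) (\<lambda>t. - y (0 - t)) q"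
      unfolding linear_solution_def
      by (intro allI conjI reflected x)
        (use has_vector_derivative_minus[OF reflected[OF y[of "0 - _"]]] q_even in auto)
    from linear_ivp_unique[OF c, of _ _ 0, OF linear_solution_diff[OF this sol, simplified]]
    show ?thesis using y0 by simp
  qed
  \<comment> \<open>Reflection about pi/2 with a change of sign preserves the equation. Both curves
    vanish at pi/2 by \<open>x_half\<close>, and there their derivatives agree
    automatically.\<close>
  have pi_refl: "x (pi - t) = - x t" for t
  proof -
    have "linear_solution c (\<lambda>t. - x (pi - t)) (\<lambda>t. y (pi - t)) q"
      unfolding linear_solution_def
      by (intro allI conjI)
        (use has_vector_derivative_minus[OF reflected[OF x]] reflected[OF y[of "pi - _"]] q_refl in
          \<open>auto simp: minus_diff_commute\<close>)
    from linear_ivp_unique[OF c, of _ _ "pi / 2", OF linear_solution_diff[OF this sol, simplified]]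
    show ?thesis using x_half by (simp add: neg_eq_iff_add_eq_0 eq_neg_iff_add_eq_0)
  qed
  have per: "x (t + pi) = - x t" for t using pi_refl[of "- t"] by (simp add: even add.commute)
  have w: "wave (\<lambda>u. u) x" using even per by (simp add: wave_def)
  interpret P: bounded_linear P by (rule P)
  have solP: "linear_solution c (\<lambda>t. P (x t)) (\<lambda>t. P (y t)) q"
    unfolding linear_solution_def
    using P.has_vector_derivative[OF x] P.has_vector_derivative[OF y]
    by (simp add: P.diff P.scaleR qP)
  \<comment> \<open>The difference solves the homogeneous problem, so the energy identity makes a
    nonnegative continuous integrand vanish. Its value at 0 supplies the data for
    uniqueness.\<close>
  let ?w = "\<lambda>t. P (x t) - x t" and ?v = "\<lambda>t. P (y t) - y t"
  have dsol: "linear_solution c ?w ?v (\<lambda>_. 0)" using linear_solution_diff[OF solP sol] by simp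
  have dw: "wave (\<lambda>u. u) ?w" using even per P.neg by (simp add: wave_def)
  have "P (x t) = x t" for t
  proof -
    have int: "((\<lambda>t. ?v t \<bullet> ?v t + c * (?w t \<bullet> ?w t)) has_integral 0) (cbox 0 (2 * pi))"
      using linear_solution_energy[OF dsol dw dsol dw] by simp
    have cont': "continuous_on (cbox 0 (2 * pi)) (\<lambda>t. ?v t \<bullet> ?v t + c * (?w t \<bullet> ?w t))"
      by (intro continuous_on_add continuous_on_inner continuous_on_mult continuous_on_const
          linear_solution_continuous[OF dsol])
    have "?v s \<bullet> ?v s + c * (?w s \<bullet> ?w s) = 0" if "s \<in> cbox 0 (2 * pi)" for s
      by (rule has_integral_0_cbox_imp_0[OF cont' _ int _ that]) (use c pi_gt_zero in \<open>auto simp del: pi_gt_zero\<close>)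
    from this[of 0] have "?v 0 \<bullet> ?v 0 + c * (?w 0 \<bullet> ?w 0) = 0" by simp
    then have "?w 0 = 0 \<and> ?v 0 = 0"
      using c by (auto simp: add_nonneg_eq_0_iff)
    then show ?thesis using linear_ivp_unique[OF c dsol, of 0 t] by simp
  qed
  then have "wave P x" using even per by (simp add: wave_def)
  then show ?thesis using sol by blast
qed

section \<open>A priori bounds\<close>

text \<open>Maximum principle: where |x|^2 is maximal, half its second derivative, x . (c x - q) +
  |y|^2, is at most 0, hence c |x|^2 <= x . q <= |x| c R. Periodicity makes the maximum over one
  period global.\<close>

lemma linear_solution_bound:
  assumes sol: "linear_solution c x y q" and w: "wave P x" and c: "c > 0"
    and q: "\<And>t. norm (q t) \<le> c * R"
  shows "norm (x t) \<le> R"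
proof -
  have "\<exists>t0\<in>{0..2 * pi}. \<forall>s\<in>{0..2 * pi}. norm (x s) \<le> norm (x t0)"
    using linear_solution_continuous(1)[OF sol]
    by (intro continuous_attains_sup continuous_intros) auto
  then obtain t0 where t0: "\<And>s. s \<in> {0..2 * pi} \<Longrightarrow> norm (x s) \<le> norm (x t0)"
    by blast
  have max: "norm (x s) \<le> norm (x t0)" for s
    using t0[OF periodic_reduce_range] periodic_reduce[of x s, OF wave_periodic[OF w]] by simp
  have "norm (x t0) \<le> R"
  proof (rule ccontr)
    assume "\<not> norm (x t0) \<le> R"
    then have gt: "norm (x t0) > R" by simp
    have "c * R \<ge> 0" using q[of 0] norm_ge_zero order_trans by blast
    then have "R \<ge> 0" using c by (simp add: zero_le_mult_iff)
    then have pos: "norm (x t0) > 0" using gt by linarith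
    have x: "(x has_vector_derivative y s) (at s)"
      and y: "(y has_vector_derivative c *\<^sub>R x s - q s) (at s)" for s
      using sol by (auto simp: linear_solution_def)
    have "((\<lambda>s. x s \<bullet> x s) has_real_derivative 2 * (x s \<bullet> y s)) (at s)" for s
      using has_vector_derivative_inner[OF x x, of s] by (simp add: inner_commute)
    moreover have "((\<lambda>s. 2 * (x s \<bullet> y s)) has_real_derivative
        2 * (x t0 \<bullet> (c *\<^sub>R x t0 - q t0) + y t0 \<bullet> y t0)) (at t0)"
      by (intro DERIV_cmult has_vector_derivative_inner x y)
    moreover have "x s \<bullet> x s \<le> x t0 \<bullet> x t0" for s
      using max[of s] by (simp add: dot_square_norm)
    ultimately have "2 * (x t0 \<bullet> (c *\<^sub>R x t0 - q t0) + y t0 \<bullet> y t0) \<le> 0"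
      by (rule second_derivative_at_max)
    then have "x t0 \<bullet> (c *\<^sub>R x t0 - q t0) + y t0 \<bullet> y t0 \<le> 0" by simp
    then have "x t0 \<bullet> (c *\<^sub>R x t0 - q t0) \<le> 0"
      using inner_ge_zero[of "y t0"] by linarith
    moreover have "x t0 \<bullet> q t0 \<le> norm (x t0) * (c * R)"
      using Cauchy_Schwarz_ineq2[of "x t0" "q t0"] mult_left_mono[OF q[of t0], of "norm (x t0)"]
      by simp
    ultimately have "c * norm (x t0) * norm (x t0) \<le> c * norm (x t0) * R"
      by (simp add: inner_diff_right dot_square_norm power2_eq_square algebra_simps)
    then show False using gt pos c by simp
  qed
  with max[of t] show ?thesis by linarith
qed

section \<open>Derivative bounds and limits of derivatives\<close>

lemma lipschitz_from_derivative:
  fixes h :: "real \<Rightarrow> 'a::real_normed_vector"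
  assumes "\<And>t. (h has_vector_derivative h' t) (at t)" and "\<And>t. norm (h' t) \<le> B"
  shows "norm (h s - h t) \<le> B * \<bar>s - t\<bar>"
proof -
  have "norm (h s - h t) \<le> B * norm (s - t)"
  proof (rule differentiable_bound[of UNIV])
    show "(h has_derivative (\<lambda>d. d *\<^sub>R h' u)) (at u within UNIV)" for u
      using assms(1) by (simp add: has_vector_derivative_def)
    show "onorm (\<lambda>d. d *\<^sub>R h' u) \<le> B" for u
      using assms(2)[of u] by (simp add: onorm_scaleR_left_lemma onorm_scaleR_left onorm_id)
  qed auto
  then show ?thesis by simp
qed

lemma linear_solution_second_derivative_bound:
  assumes "\<And>t. norm (x t) \<le> R" and "\<And>t. norm (q t) \<le> c * R" and "c > 0"
  shows "norm (c *\<^sub>R x t - q t) \<le> 2 * c * R"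
proof -
  have "norm (c *\<^sub>R x t) \<le> c * R" using assms(1)[of t] assms(3) by simp
  then show ?thesis
    using norm_triangle_ineq4[of "c *\<^sub>R x t" "q t"] assms(2)[of t] by linarith
qed

text \<open>The derivative vanishes at 0 and changes at rate at most 2 c R. Within a period of
  length 2 pi this gives the bound, and periodicity extends it.\<close>

lemma linear_solution_deriv_bound:
  assumes sol: "linear_solution c x y q" and w: "wave P x" and c: "c > 0"
    and x: "\<And>t. norm (x t) \<le> R" and q: "\<And>t. norm (q t) \<le> c * R"
  shows "norm (y t) \<le> 4 * pi * c * R"
proof -
  let ?s = "2 * pi * frac (t / (2 * pi))"
  have "c * R \<ge> 0" using q[of 0] norm_ge_zero order_trans by blast
  have "norm (y ?s - y 0) \<le> 2 * c * R * \<bar>?s - 0\<bar>"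
    by (rule lipschitz_from_derivative[where h' = "\<lambda>t. c *\<^sub>R x t - q t"])
      (use sol linear_solution_second_derivative_bound[OF x q c] in \<open>auto simp: linear_solution_def\<close>)
  also have "\<dots> \<le> 2 * c * R * (2 * pi)"
    using periodic_reduce_range[of t] \<open>c * R \<ge> 0\<close> by (intro mult_left_mono) (auto simp: mult.assoc)
  finally show ?thesis
    using periodic_reduce[of y t, OF linear_solution_deriv_periodic[OF sol w]]
      linear_solution_deriv_0[OF sol w] by (simp add: mult_ac)
qed

text \<open>Passes to the limit in either equation of the first-order system: uniform convergence of
  the derivatives allows the exchange, and pointwise convergence of the curves identifies the
  limit.\<close>

lemma uniform_limit_has_vector_derivative:
  fixes h :: "nat \<Rightarrow> real \<Rightarrow> 'a::banach"
  assumes h: "\<And>n t. (h n has_vector_derivative h' n t) (at t)"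
    and h': "uniform_limit UNIV h' l' sequentially"
    and l: "\<And>t. (\<lambda>n. h n t) \<longlonglongrightarrow> l t"
  shows "(l has_vector_derivative l' t) (at t)"
proof -
  have "\<exists>g. \<forall>t\<in>UNIV. (\<lambda>n. h n t) \<longlonglongrightarrow> g t \<and> (g has_derivative (\<lambda>d. d *\<^sub>R l' t)) (at t within UNIV)"
  proof (rule has_derivative_sequence[where f' = "\<lambda>n t d. d *\<^sub>R h' n t" and f = h and ?x0.0 = 0 and l = "l 0"])
    show "(h n has_derivative (\<lambda>d. d *\<^sub>R h' n t)) (at t within UNIV)" for n t
      using h[of n t] by (simp add: has_vector_derivative_def)
    show "\<forall>\<^sub>F n in sequentially. \<forall>t\<in>UNIV. \<forall>d. norm (d *\<^sub>R h' n t - d *\<^sub>R l' t) \<le> e * norm d"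
      if "e > 0" for e
      using uniform_limitD[OF h' that]
    proof eventually_elim
      case (elim n)
      then show ?case
        by (auto simp: dist_norm less_imp_le mult.commute[of e] simp flip: scaleR_diff_right intro!: mult_left_mono)
    qed
  qed (use l in auto)
  then obtain g where g: "\<And>t. (\<lambda>n. h n t) \<longlonglongrightarrow> g t" "\<And>t. (g has_vector_derivative l' t) (at t)"
    by (auto simp: has_vector_derivative_def)
  have "g = l" using LIMSEQ_unique[OF g(1) l] by auto
  with g(2) show ?thesis by simp
qed

section \<open>The descent step\<close>

text \<open>\<open>ball\<close> bounds the right-hand side of the linear problem, so that the
  maximum principle keeps the iterates in the ball; \<open>lipschitz\<close> makes \<open>H\<close>
  convex there. In the application \<open>f\<close> contains the factor lambda^2.\<close>

locale gradient_system =
  fixes f :: "'a::euclidean_space \<Rightarrow> 'a" and F :: "'a \<Rightarrow> real" and P :: "'a \<Rightarrow> 'a"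
    and R c :: real
  assumes gradient: "\<And>u. (F has_derivative (\<lambda>h. f u \<bullet> h)) (at u)"
    and F_0: "F 0 = 0"
    and f_odd: "\<And>u. f (- u) = - f u"
    and P_linear: "bounded_linear P"
    and f_P: "\<And>u. P u = u \<Longrightarrow> P (f u) = f u"
    and R_pos: "R > 0" and c_pos: "c > 0"
    and ball: "\<And>u. norm u \<le> R \<Longrightarrow> norm (c *\<^sub>R u - f u) \<le> c * R"
    and lipschitz: "\<And>u v. norm u \<le> R \<Longrightarrow> norm v \<le> R \<Longrightarrow> norm (f u - f v) \<le> c * norm (u - v)"
begin

definition k :: "'a \<Rightarrow> 'a" where "k u = c *\<^sub>R u - f u"

definition H :: "'a \<Rightarrow> real" where "H u = c / 2 * (u \<bullet> u) - F u"

text \<open>A state of the iteration: a curve, its derivative and the right-hand side that produced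
  it. The two bounds are the ones that a step preserves.\<close>

definition admissible :: "(real \<Rightarrow> 'a) \<Rightarrow> (real \<Rightarrow> 'a) \<Rightarrow> (real \<Rightarrow> 'a) \<Rightarrow> bool" where
  "admissible x y q \<longleftrightarrow> linear_solution c x y q \<and> wave P x \<and> continuous_on UNIV q \<and>
     (\<forall>t. norm (x t) \<le> R) \<and> (\<forall>t. norm (q t) \<le> c * R)"

text \<open>By the energy identity \<open>q t \<bullet> x t\<close> has the same integral as |x'|^2
  + c |x|^2, so this is the integral of |x'|^2 / 2 + F(x), written without derivatives.\<close>

definition action :: "(real \<Rightarrow> 'a) \<Rightarrow> (real \<Rightarrow> 'a) \<Rightarrow> real" where
  "action x q = integral {0..2 * pi} (\<lambda>t. (q t \<bullet> x t) / 2 - H (x t))"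

section \<open>Convexity of \<open>H\<close> on the ball\<close>

lemma k_lipschitz: "norm u \<le> R \<Longrightarrow> norm v \<le> R \<Longrightarrow> norm (k u - k v) \<le> 2 * c * norm (u - v)"
proof -
  assume *: "norm u \<le> R" "norm v \<le> R"
  have "k u - k v = c *\<^sub>R (u - v) - (f u - f v)" by (simp add: k_def algebra_simps)
  then have "norm (k u - k v) \<le> norm (c *\<^sub>R (u - v)) + norm (f u - f v)"
    by (simp only: norm_triangle_ineq4)
  also have "\<dots> \<le> c * norm (u - v) + c * norm (u - v)"
    using lipschitz[OF *] c_pos by (simp add: abs_of_pos)
  finally show ?thesis by simp
qed

lemma k_monotone:
  assumes "norm u \<le> R" "norm v \<le> R"
  shows "0 \<le> (k u - k v) \<bullet> (u - v)"
proof -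
  have "(f u - f v) \<bullet> (u - v) \<le> norm (f u - f v) * norm (u - v)"
    by (rule norm_cauchy_schwarz)
  also have "\<dots> \<le> c * norm (u - v) * norm (u - v)"
    using lipschitz[OF assms] by (intro mult_right_mono) auto
  also have "\<dots> = c * ((u - v) \<bullet> (u - v))" by (simp add: dot_square_norm power2_eq_square)
  finally show ?thesis
    by (simp add: k_def inner_diff_left algebra_simps inner_diff_right)
qed

lemma H_has_derivative: "(H has_derivative (\<lambda>h. k u \<bullet> h)) (at u)"
  unfolding H_def k_def
  by (auto intro!: derivative_eq_intros gradient
      simp: inner_diff_left inner_diff_right inner_commute fun_eq_iff)

lemma continuous_on_H: "continuous_on S H"
  using H_has_derivative has_derivative_continuous continuous_at_imp_continuous_on by blast

lemma continuous_on_k: "continuous_on (cball 0 R) k"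
proof (rule lipschitz_on_continuous_on)
  show "(2 * c)-lipschitz_on (cball 0 R) k"
    using k_lipschitz c_pos by (auto simp: lipschitz_on_def dist_norm)
qed

text \<open>By the mean value theorem on the segment the increment of \<open>H\<close> is k(w s) .
  (v - u) for some s, and monotonicity of \<open>k\<close> between \<open>u\<close> and
  \<open>w s\<close> bounds this below by k u . (v - u).\<close>

lemma H_convex:
  assumes u: "norm u \<le> R" and v: "norm v \<le> R"
  shows "H u + k u \<bullet> (v - u) \<le> H v"
proof -
  define w where "w s = u + s *\<^sub>R (v - u)" for s :: real
  have dH: "((\<lambda>s. H (w s)) has_real_derivative k (w s) \<bullet> (v - u)) (at s)" for s
  proof -
    have "(w has_derivative (\<lambda>h. h *\<^sub>R (v - u))) (at s)"
      unfolding w_def by (auto intro!: derivative_eq_intros)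
    from has_derivative_compose[OF this H_has_derivative]
    show ?thesis by (simp add: has_field_derivative_def mult.commute[of _ "k _ \<bullet> _"])
  qed
  then obtain s where s: "0 < s" "s < 1" "H (w 1) - H (w 0) = (1 - 0) * (k (w s) \<bullet> (v - u))"
    using MVT2[of 0 1 "\<lambda>s. H (w s)" "\<lambda>s. k (w s) \<bullet> (v - u)", OF _ dH] by auto
  have "w s = (1 - s) *\<^sub>R u + s *\<^sub>R v" by (simp add: w_def algebra_simps)
  then have "norm (w s) \<le> R"
    using convexD_alt[OF convex_cball[of 0 R], of u v s] u v s by simp
  then have "0 \<le> (k (w s) - k u) \<bullet> (w s - u)" using k_monotone u by blast
  then have "0 \<le> s * ((k (w s) - k u) \<bullet> (v - u))" by (simp add: w_def)
  then have "k u \<bullet> (v - u) \<le> k (w s) \<bullet> (v - u)"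
    using s(1) by (simp add: zero_le_mult_iff inner_diff_left)
  then show ?thesis using s(3) by (simp add: w_def)
qed

text \<open>Oddness of \<open>f\<close> makes \<open>k\<close> of a wave antiperiodic,
  \<open>f_P\<close> keeps it in the fixed space of \<open>P\<close>, and \<open>ball\<close> bounds
  it by c R, so the linear problem can be solved within the class.\<close>

lemma admissible_step:
  assumes "admissible x y q"
  shows "\<exists>x' y'. admissible x' y' (\<lambda>t. k (x t))"
proof -
  interpret P: bounded_linear P by (rule P_linear)
  have *: "linear_solution c x y q" "wave P x" "\<And>t. norm (x t) \<le> R"
    using assms by (auto simp: admissible_def)
  have cont: "continuous_on UNIV (\<lambda>t. k (x t))"
    by (rule continuous_on_compose2[OF continuous_on_k linear_solution_continuous(1)[OF *(1)]])
      (use *(3) in auto)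
  have "wave P (\<lambda>t. k (x t))"
    using *(2) by (simp add: wave_def k_def f_odd P.diff P.scaleR f_P)
  then obtain x' y' where 1: "linear_solution c x' y' (\<lambda>t. k (x t))" "wave P x'"
    using linear_solution_exists[OF c_pos cont _ P_linear] by blast
  have 2: "norm (k (x t)) \<le> c * R" for t using ball *(3) by (simp add: k_def)
  have "norm (x' t) \<le> R" for t by (rule linear_solution_bound[OF 1 c_pos 2])
  then show ?thesis using 1 2 cont by (auto simp: admissible_def)
qed

section \<open>Energy identity and descent of the action\<close>

lemma admissible_integrable:
  assumes "admissible x y q" "admissible x' y' q'"
  shows "(\<lambda>t. q t \<bullet> x' t) integrable_on {0..2 * pi}" "(\<lambda>t. H (x t)) integrable_on {0..2 * pi}"
    "(\<lambda>t. x t \<bullet> x' t) integrable_on {0..2 * pi}" "(\<lambda>t. y t \<bullet> y' t) integrable_on {0..2 * pi}"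
proof -
  have c: "continuous_on {0..2 * pi} x" "continuous_on {0..2 * pi} y" "continuous_on {0..2 * pi} q"
    "continuous_on {0..2 * pi} x'" "continuous_on {0..2 * pi} y'"
    using assms linear_solution_continuous continuous_on_subset unfolding admissible_def by blast+
  show "(\<lambda>t. q t \<bullet> x' t) integrable_on {0..2 * pi}"
    "(\<lambda>t. x t \<bullet> x' t) integrable_on {0..2 * pi}" "(\<lambda>t. y t \<bullet> y' t) integrable_on {0..2 * pi}"
    by (intro integrable_continuous_interval continuous_intros c)+
  show "(\<lambda>t. H (x t)) integrable_on {0..2 * pi}"
    by (intro integrable_continuous_interval continuous_on_compose2[OF continuous_on_H c(1)]) auto
qed

lemma admissible_energy:
  assumes "admissible x y q" "admissible x' y' q'"
  shows "integral {0..2 * pi} (\<lambda>t. q t \<bullet> x' t) =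
    integral {0..2 * pi} (\<lambda>t. y t \<bullet> y' t) + c * integral {0..2 * pi} (\<lambda>t. x t \<bullet> x' t)"
proof -
  have "((\<lambda>t. y t \<bullet> y' t + c * (x t \<bullet> x' t) - q t \<bullet> x' t) has_integral 0) {0..2 * pi}"
    using assms linear_solution_energy unfolding admissible_def by blast
  moreover have "((\<lambda>t. y t \<bullet> y' t + c * (x t \<bullet> x' t) - q t \<bullet> x' t) has_integral
      (integral {0..2 * pi} (\<lambda>t. y t \<bullet> y' t) + c * integral {0..2 * pi} (\<lambda>t. x t \<bullet> x' t)
        - integral {0..2 * pi} (\<lambda>t. q t \<bullet> x' t))) {0..2 * pi}"
    by (intro has_integral_diff has_integral_add has_integral_mult_right integrable_integral
        admissible_integrable[OF assms])
  ultimately have "0 = integral {0..2 * pi} (\<lambda>t. y t \<bullet> y' t)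
      + c * integral {0..2 * pi} (\<lambda>t. x t \<bullet> x' t) - integral {0..2 * pi} (\<lambda>t. q t \<bullet> x' t)"
    by (rule has_integral_unique)
  then show ?thesis by simp
qed

text \<open>By the energy identity the quadratic part of the action is an integral of
  squares.\<close>

lemma action_bounded_below:
  assumes "admissible x y q"
  shows "- integral {0..2 * pi} (\<lambda>t. H (x t)) \<le> action x q"
proof -
  note int = admissible_integrable[OF assms assms]
  have "0 \<le> integral {0..2 * pi} (\<lambda>t. q t \<bullet> x t)"
    unfolding admissible_energy[OF assms assms] using c_pos
    by (intro add_nonneg_nonneg mult_nonneg_nonneg integral_nonneg int) auto
  then show ?thesis
    unfolding action_def using int by (simp add: integral_diff integrable_on_divide)
qed

text \<open>Convexity bounds \<open>H (x t) - H (x' t)\<close> by a linear term. With the energy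
  identities the resulting upper bound for the change of the action is minus half the integral of
  |y' - y|^2 + c |x' - x|^2, and the derivative part is discarded.\<close>

lemma action_descent:
  assumes 1: "admissible x y q" and 2: "admissible x' y' (\<lambda>t. k (x t))"
  shows "action x' (\<lambda>t. k (x t)) + c / 2 * integral {0..2 * pi} (\<lambda>t. (norm (x' t - x t))\<^sup>2)
    \<le> action x q"
proof -
  let ?I = "integral {0..2 * pi}" and ?q' = "\<lambda>t. k (x t)"
  note i11 = admissible_integrable[OF 1 1] and i12 = admissible_integrable[OF 1 2]
    and i21 = admissible_integrable[OF 2 1] and i22 = admissible_integrable[OF 2 2]
  have n: "norm (x t) \<le> R" "norm (x' t) \<le> R" for t using 1 2 by (auto simp: admissible_def)
  have "action x' ?q' - action x q =
      ?I (\<lambda>t. (?q' t \<bullet> x' t) / 2 - H (x' t) - ((q t \<bullet> x t) / 2 - H (x t)))"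
    unfolding action_def using i11 i22
    by (intro integral_diff[symmetric] integrable_diff integrable_on_divide) auto
  also have "\<dots> \<le> ?I (\<lambda>t. ?q' t \<bullet> x t - (?q' t \<bullet> x' t) / 2 - (q t \<bullet> x t) / 2)"
  proof (rule integral_le)
    fix t
    show "?q' t \<bullet> x' t / 2 - H (x' t) - (q t \<bullet> x t / 2 - H (x t))
        \<le> ?q' t \<bullet> x t - ?q' t \<bullet> x' t / 2 - q t \<bullet> x t / 2"
      using H_convex[OF n, of t t] by (simp add: inner_diff_right)
  qed (use i11 i22 i21 in \<open>auto intro!: integrable_diff integrable_on_divide\<close>)
  also have "\<dots> = ?I (\<lambda>t. ?q' t \<bullet> x t) - ?I (\<lambda>t. ?q' t \<bullet> x' t) / 2 - ?I (\<lambda>t. q t \<bullet> x t) / 2"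
    using i11 i22 i21 by (simp add: integral_diff integrable_diff integrable_on_divide)
  also have "\<dots> = ?I (\<lambda>t. y' t \<bullet> y t) - ?I (\<lambda>t. y' t \<bullet> y' t) / 2 - ?I (\<lambda>t. y t \<bullet> y t) / 2
     + c * (?I (\<lambda>t. x' t \<bullet> x t) - ?I (\<lambda>t. x' t \<bullet> x' t) / 2 - ?I (\<lambda>t. x t \<bullet> x t) / 2)"
    unfolding admissible_energy[OF 2 1] admissible_energy[OF 2 2] admissible_energy[OF 1 1]
    by (simp add: algebra_simps add_divide_distrib)
  also have "\<dots> \<le> - (c / 2) * ?I (\<lambda>t. (norm (x' t - x t))\<^sup>2)"
  proof -
    have sq: "?I (\<lambda>t. (norm (b t - a t))\<^sup>2) = ?I (\<lambda>t. b t \<bullet> b t) - 2 * ?I (\<lambda>t. b t \<bullet> a t) + ?I (\<lambda>t. a t \<bullet> a t)"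
      if "(\<lambda>t. b t \<bullet> b t) integrable_on {0..2 * pi}" "(\<lambda>t. b t \<bullet> a t) integrable_on {0..2 * pi}"
        "(\<lambda>t. a t \<bullet> a t) integrable_on {0..2 * pi}" for a b :: "real \<Rightarrow> 'a"
    proof -
      have "(norm (b t - a t))\<^sup>2 = b t \<bullet> b t - 2 * (b t \<bullet> a t) + a t \<bullet> a t" for t
        by (simp add: power2_norm_eq_inner inner_diff_left inner_diff_right inner_commute)
      then show ?thesis
        using that by (simp add: integral_diff integral_add integrable_diff integrable_on_cmult_left)
    qed
    have "0 \<le> ?I (\<lambda>t. (norm (y' t - y t))\<^sup>2)"
      by (rule Henstock_Kurzweil_Integration.integral_nonneg)
         (use linear_solution_continuous(2) 1 2 in
           \<open>auto simp: admissible_def intro!: integrable_continuous_interval continuous_intros\<close>)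
    then have "?I (\<lambda>t. y' t \<bullet> y t) - ?I (\<lambda>t. y' t \<bullet> y' t) / 2 - ?I (\<lambda>t. y t \<bullet> y t) / 2 \<le> 0"
      using sq[OF i22(4) i21(4) i11(4)] by simp
    moreover have "- (c / 2) * ?I (\<lambda>t. (norm (x' t - x t))\<^sup>2) =
        c * (?I (\<lambda>t. x' t \<bullet> x t) - ?I (\<lambda>t. x' t \<bullet> x' t) / 2 - ?I (\<lambda>t. x t \<bullet> x t) / 2)"
      unfolding sq[OF i22(3) i21(3) i11(3)] by (simp add: field_simps)
    ultimately show ?thesis by linarith
  qed
  finally show ?thesis by simp
qed

end

section \<open>Convergence of the descent\<close>

lemma dominated_convergence_interval:
  fixes h :: "nat \<Rightarrow> real \<Rightarrow> real"
  assumes "\<And>n. (h n) integrable_on {a..b}" and "\<And>n t. \<bar>h n t\<bar> \<le> B" and "\<And>t. (\<lambda>n. h n t) \<longlonglongrightarrow> l t"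
  shows "(\<lambda>n. integral {a..b} (h n)) \<longlonglongrightarrow> integral {a..b} l"
  by (rule dominated_convergence(2)[where h = "\<lambda>_. B"]) (use assms in auto)

context gradient_system
begin

text \<open>The constants depend only on \<open>c\<close> and \<open>R\<close>; this uniformity
  along the iteration gives the equicontinuity for Arzela-Ascoli.\<close>

lemma admissible_lipschitz:
  assumes "admissible x y q"
  shows "norm (x s - x t) \<le> 4 * pi * c * R * \<bar>s - t\<bar>" "norm (y s - y t) \<le> 2 * c * R * \<bar>s - t\<bar>"
    "norm (y t) \<le> 4 * pi * c * R"
proof -
  have *: "linear_solution c x y q" "wave P x" "\<And>t. norm (x t) \<le> R" "\<And>t. norm (q t) \<le> c * R"
    using assms by (auto simp: admissible_def)
  show y: "norm (y t) \<le> 4 * pi * c * R" for t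
    by (rule linear_solution_deriv_bound[OF *(1,2) c_pos *(3,4)])
  show "norm (x s - x t) \<le> 4 * pi * c * R * \<bar>s - t\<bar>"
    by (rule lipschitz_from_derivative[where h' = y]) (use *(1) y in \<open>auto simp: linear_solution_def\<close>)
  show "norm (y s - y t) \<le> 2 * c * R * \<bar>s - t\<bar>"
    by (rule lipschitz_from_derivative[where h' = "\<lambda>t. c *\<^sub>R x t - q t"])
      (use *(1) linear_solution_second_derivative_bound[OF *(3,4) c_pos] in \<open>auto simp: linear_solution_def\<close>)
qed

lemma H_bounded:
  "\<exists>B. \<forall>u. norm u \<le> R \<longrightarrow> \<bar>H u\<bar> \<le> B"
proof -
  have "compact (H ` cball 0 R)" by (intro compact_continuous_image continuous_on_H) auto
  then obtain B where "\<forall>v\<in>H ` cball 0 R. norm v \<le> B"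
    using compact_imp_bounded bounded_iff by blast
  then show ?thesis by (auto intro!: exI[of _ B])
qed

text \<open>The actions decrease and are bounded below, hence converge, and the drop in each step
  controls the squared L2 distance of consecutive curves.\<close>

lemma descent_sequence:
  assumes adm: "admissible x0 y0 q0"
  obtains X Y Q where "\<And>n. admissible (X n) (Y n) (Q n)" "\<And>n. Q (Suc n) = (\<lambda>t. k (X n t))"
    "\<And>n. action (X n) (Q n) \<le> action x0 q0"
    "(\<lambda>n. integral {0..2 * pi} (\<lambda>t. (norm (X (Suc n) t - X n t))\<^sup>2)) \<longlonglongrightarrow> 0"
proof -
  \<comment> \<open>The clause for \<open>n = 0\<close> pins the start of the dependent choice to
    the given state.\<close>
  let ?adm = "\<lambda>(n::nat) (x, y, q). admissible x y q \<and> (n = 0 \<longrightarrow> (x, y, q) = (x0, y0, q0))"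
  have "\<exists>S. \<forall>n. ?adm n (S n) \<and> snd (snd (S (Suc n))) = (\<lambda>t. k (fst (S n) t))"
  proof (rule dependent_nat_choice)
    show "\<exists>z. ?adm 0 z" using adm by auto
    fix z n assume "?adm n z"
    then obtain x y q where "z = (x, y, q)" "admissible x y q" by auto
    then show "\<exists>z'. ?adm (Suc n) z' \<and> snd (snd z') = (\<lambda>t. k (fst z t))"
      using admissible_step[of x y q] by auto
  qed
  then obtain S where "\<forall>n. ?adm n (S n) \<and> snd (snd (S (Suc n))) = (\<lambda>t. k (fst (S n) t))"
    by (rule exE)
  then have S: "?adm n (S n)" "snd (snd (S (Suc n))) = (\<lambda>t. k (fst (S n) t))" for n
    by simp_all
  define X Y Q where "X n = fst (S n)" and "Y n = fst (snd (S n))" and "Q n = snd (snd (S n))" for n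
  have X: "admissible (X n) (Y n) (Q n)" for n
    using S(1)[of n] by (simp add: X_def Y_def Q_def split_beta)
  have Q: "Q (Suc n) = (\<lambda>t. k (X n t))" for n using S(2) by (simp add: X_def Q_def)
  have 0: "X 0 = x0" "Q 0 = q0" using S(1)[of 0] by (simp_all add: X_def Q_def split_beta prod_eq_iff)
  define D where "D n = integral {0..2 * pi} (\<lambda>t. (norm (X (Suc n) t - X n t))\<^sup>2)" for n
  define A where "A n = action (X n) (Q n)" for n
  have D_nonneg: "D n \<ge> 0" for n
  proof -
    have "continuous_on {0..2 * pi} (X m)" for m
      using X[of m] linear_solution_continuous(1) by (auto simp: admissible_def)
    then show ?thesis unfolding D_def
      by (intro Henstock_Kurzweil_Integration.integral_nonneg integrable_continuous_interval continuous_intros) auto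
  qed
  have descent: "A (Suc n) + c / 2 * D n \<le> A n" for n
    using action_descent[OF X[of n], of "X (Suc n)" "Y (Suc n)"] X[of "Suc n"]
    by (simp add: A_def D_def Q)
  have "A (Suc n) \<le> A n" for n
    using descent[of n] mult_nonneg_nonneg[of "c / 2" "D n"] c_pos D_nonneg[of n] by linarith
  then have dec: "decseq A" by (rule decseq_SucI)
  obtain B where "\<forall>u. norm u \<le> R \<longrightarrow> \<bar>H u\<bar> \<le> B" using H_bounded by blast
  then have B: "H u \<le> B" if "norm u \<le> R" for u using that abs_le_D1 by blast
  have "- (B * (2 * pi)) \<le> A n" for n
  proof -
    have "integral {0..2 * pi} (\<lambda>t. H (X n t)) \<le> integral {0..2 * pi} (\<lambda>t. B)"
      using B X[of n] admissible_integrable(2)[OF X X]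
      by (intro integral_le) (auto simp: admissible_def)
    then show ?thesis using action_bounded_below[OF X[of n]] by (simp add: A_def mult.commute)
  qed
  then obtain l where l: "A \<longlonglongrightarrow> l" using decseq_convergent[OF dec] by blast
  have "(\<lambda>n. 2 / c * (A n - A (Suc n))) \<longlonglongrightarrow> 2 / c * (l - l)"
    by (intro tendsto_intros l LIMSEQ_Suc)
  moreover have "D n \<le> 2 / c * (A n - A (Suc n))" for n
    using descent[of n] c_pos by (simp add: field_simps)
  ultimately have "D \<longlonglongrightarrow> 0"
    by (intro tendsto_sandwich[of "\<lambda>_. 0" D _ "\<lambda>n. 2 / c * (A n - A (Suc n))"])
      (use D_nonneg in auto)
  moreover have "A n \<le> action x0 q0" for n
    using decseqD[OF dec, of 0 n] 0 by (simp add: A_def)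
  ultimately show ?thesis using that[of X Y Q] X Q by (simp add: A_def D_def[abs_def])
qed

text \<open>All three sequences must converge along the same \<open>r\<close>, so Arzela-Ascoli is
  applied once, to the triple. The index \<open>Suc (r n)\<close> is the successor in the full
  iteration, since a step links consecutive curves.\<close>

lemma admissible_subsequence_limit:
  assumes X: "\<And>n. admissible (X n) (Y n) (Q n)" and Q: "\<And>n. Q (Suc n) = (\<lambda>t. k (X n t))"
  obtains r x z y where "strict_mono (r :: nat \<Rightarrow> nat)"
    "uniform_limit UNIV (\<lambda>n. X (r n)) x sequentially"
    "uniform_limit UNIV (\<lambda>n. X (Suc (r n))) z sequentially"
    "uniform_limit UNIV (\<lambda>n. Y (Suc (r n))) y sequentially"
proof -
  define \<F> where "\<F> n t = (X n t, X (Suc n) t, Y (Suc n) t)" for n t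
  define K where "K = 4 * pi * c * R"
  have K: "K > 0" using c_pos R_pos by (simp add: K_def)
  have per: "\<F> n (t + 2 * pi) = \<F> n t" for n t
  proof -
    have "linear_solution c (X m) (Y m) (Q m)" "wave P (X m)" for m
      using X[of m] by (auto simp: admissible_def)
    then show ?thesis
      using wave_periodic linear_solution_deriv_periodic by (metis \<F>_def)
  qed
  have "norm (\<F> n t) \<le> R + (R + K)" for n t
  proof -
    have tri: "norm (\<F> n t) \<le> norm (X n t) + (norm (X (Suc n) t) + norm (Y (Suc n) t))"
      unfolding \<F>_def using norm_Pair_le[of "X n t" "(X (Suc n) t, Y (Suc n) t)"]
        norm_Pair_le[of "X (Suc n) t" "Y (Suc n) t"] by linarith
    have "norm (X m t) \<le> R" "norm (Y m t) \<le> K" for m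
      using X[of m] admissible_lipschitz(3)[OF X[of m]] by (auto simp: admissible_def K_def)
    from this(1)[of n] this(1)[of "Suc n"] this(2)[of "Suc n"] tri
    show ?thesis by linarith
  qed
  moreover have lip: "norm (\<F> n s - \<F> n t) \<le> 3 * K * \<bar>s - t\<bar>" for n s t
  proof -
    have tri: "norm (\<F> n s - \<F> n t) \<le> norm (X n s - X n t) +
        (norm (X (Suc n) s - X (Suc n) t) + norm (Y (Suc n) s - Y (Suc n) t))"
      unfolding \<F>_def using norm_Pair_le[of "X n s - X n t" "(X (Suc n) s - X (Suc n) t, Y (Suc n) s - Y (Suc n) t)"]
        norm_Pair_le[of "X (Suc n) s - X (Suc n) t" "Y (Suc n) s - Y (Suc n) t"] by simp
    have "norm (X m s - X m t) \<le> K * \<bar>s - t\<bar>" "norm (Y m s - Y m t) \<le> K * \<bar>s - t\<bar>" for m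
    proof -
      show "norm (X m s - X m t) \<le> K * \<bar>s - t\<bar>"
        using admissible_lipschitz(1)[OF X[of m]] by (simp add: K_def)
      have "2 * c * R \<le> K" using c_pos R_pos pi_gt3 by (simp add: K_def)
      then show "norm (Y m s - Y m t) \<le> K * \<bar>s - t\<bar>"
        using admissible_lipschitz(2)[OF X[of m], of s t] mult_right_mono[of "2 * c * R" K "\<bar>s - t\<bar>"]
        by linarith
    qed
    from this(1)[of n] this(1)[of "Suc n"] this(2)[of "Suc n"] tri
    have "norm (\<F> n s - \<F> n t) \<le> K * \<bar>s - t\<bar> + (K * \<bar>s - t\<bar> + K * \<bar>s - t\<bar>)" by linarith
    then show ?thesis by simp
  qed
  have equi: "\<exists>d. 0 < d \<and> (\<forall>n t. t \<in> {0..2 * pi} \<and> norm (s - t) < d \<longrightarrow> norm (\<F> n s - \<F> n t) < e)"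
    if "e > 0" for s e
  proof (intro exI conjI allI impI)
    show "0 < e / (3 * K)" using that K by simp
    fix n t assume "t \<in> {0..2 * pi} \<and> norm (s - t) < e / (3 * K)"
    then have "3 * K * \<bar>s - t\<bar> < e" using K by (simp add: field_simps)
    then show "norm (\<F> n s - \<F> n t) < e" using lip[of n s t] by linarith
  qed
  ultimately obtain G0 and r :: "nat \<Rightarrow> nat" where r: "strict_mono r"
    and lim: "\<And>e. 0 < e \<Longrightarrow> \<exists>N. \<forall>n t. n \<ge> N \<and> t \<in> {0..2 * pi} \<longrightarrow> norm (\<F> (r n) t - G0 t) < e"
    using Arzela_Ascoli[of "{0..2 * pi}" \<F> "R + (R + K)"] by (metis compact_Icc)
  \<comment> \<open>Arzela-Ascoli gives a limit on one period only; its periodic extension makes the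
    convergence uniform on the whole line.\<close>
  define G where "G t = G0 (2 * pi * frac (t / (2 * pi)))" for t
  have unif: "uniform_limit UNIV (\<lambda>n. \<F> (r n)) G sequentially"
  proof (rule uniform_limitI)
    fix e :: real assume "e > 0"
    then obtain N where N: "\<And>n t. n \<ge> N \<Longrightarrow> t \<in> {0..2 * pi} \<Longrightarrow> norm (\<F> (r n) t - G0 t) < e"
      using lim by blast
    have "dist (\<F> (r n) t) (G t) < e" if "n \<ge> N" for n t
      using N[OF that periodic_reduce_range[of t]] periodic_reduce[of "\<F> (r n)" t, OF per]
      by (simp add: G_def dist_norm)
    then show "\<forall>\<^sub>F n in sequentially. \<forall>t\<in>UNIV. dist (\<F> (r n) t) (G t) < e"
      by (auto simp: eventually_sequentially)
  qed
  note u1 = bounded_linear.uniform_limit[OF bounded_linear_fst unif]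
    and u2 = bounded_linear.uniform_limit[OF bounded_linear_snd unif]
  note u21 = bounded_linear.uniform_limit[OF bounded_linear_fst u2]
    and u22 = bounded_linear.uniform_limit[OF bounded_linear_snd u2]
  show ?thesis using that[OF r] u1 u21 u22 by (simp add: \<F>_def)
qed

text \<open>Consecutive curves have the same limit, so the step equation becomes x'' = c x - k(x) =
  f(x). The negative initial action excludes the limit zero.\<close>

theorem critical_point_exists:
  assumes adm: "admissible x0 y0 q0" and neg: "action x0 q0 < 0"
  obtains x y where "\<And>t. (x has_vector_derivative y t) (at t)"
    "\<And>t. (y has_vector_derivative f (x t)) (at t)" "wave P x" "\<exists>t. x t \<noteq> 0"
proof -
  obtain X Y Q where X: "\<And>n. admissible (X n) (Y n) (Q n)" and Q: "\<And>n. Q (Suc n) = (\<lambda>t. k (X n t))"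
    and act: "\<And>n. action (X n) (Q n) \<le> action x0 q0"
    and D: "(\<lambda>n. integral {0..2 * pi} (\<lambda>t. (norm (X (Suc n) t - X n t))\<^sup>2)) \<longlonglongrightarrow> 0"
    using descent_sequence[OF adm] by blast
  obtain r x z y where r: "strict_mono (r :: nat \<Rightarrow> nat)"
    and x: "uniform_limit UNIV (\<lambda>n. X (r n)) x sequentially"
    and z: "uniform_limit UNIV (\<lambda>n. X (Suc (r n))) z sequentially"
    and y: "uniform_limit UNIV (\<lambda>n. Y (Suc (r n))) y sequentially"
    by (rule admissible_subsequence_limit[of X Y Q, OF X Q])
  have Xsol: "linear_solution c (X n) (Y n) (Q n)" and Xw: "wave P (X n)"
    and Xb: "norm (X n t) \<le> R" for n t
    using X[of n] by (auto simp: admissible_def)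
  have xt: "(\<lambda>n. X (r n) t) \<longlonglongrightarrow> x t" and zt: "(\<lambda>n. X (Suc (r n)) t) \<longlonglongrightarrow> z t"
    and yt: "(\<lambda>n. Y (Suc (r n)) t) \<longlonglongrightarrow> y t" for t
    using x y z by (auto intro: tendsto_uniform_limitI)
  have xb: "norm (x t) \<le> R" for t
    by (rule Lim_norm_ubound[OF _ xt]) (simp_all add: Xb)
  have cont: "continuous_on S (X n)" for S n
    using linear_solution_continuous(1)[OF Xsol] .
  have xcont: "continuous_on UNIV x"
    by (rule uniform_limit_theorem[OF _ x]) (simp_all add: cont)
  have zcont: "continuous_on UNIV z"
    by (rule uniform_limit_theorem[OF _ z]) (simp_all add: cont)
  interpret P: bounded_linear P by (rule P_linear)
  have w: "wave P x"
    unfolding wave_def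
  proof (intro conjI allI)
    fix t
    show "x (- t) = x t"
      using LIMSEQ_unique[OF xt[of "- t"]] xt[of t] Xw by (simp add: wave_def)
    show "x (t + pi) = - x t"
      using LIMSEQ_unique[OF xt[of "t + pi"]] tendsto_minus[OF xt[of t]] Xw by (simp add: wave_def)
    show "P (x t) = x t"
      using LIMSEQ_unique[OF P.tendsto[OF xt[of t]]] xt[of t] Xw by (simp add: wave_def)
  qed
  have wz: "z (t + 2 * pi) = z t" for t
    using LIMSEQ_unique[OF zt[of "t + 2 * pi"]] zt[of t] wave_periodic[OF Xw] by simp
  \<comment> \<open>Dominated convergence transfers the vanishing L2 distance to the limits;
    continuity and periodicity turn it into pointwise equality.\<close>
  have "z t = x t" for t
  proof -
    let ?h = "\<lambda>n t. (norm (X (Suc (r n)) t - X (r n) t))\<^sup>2"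
    have "\<bar>?h n t\<bar> \<le> (2 * R)\<^sup>2" for n t
    proof -
      have "norm (X (Suc (r n)) t - X (r n) t) \<le> 2 * R"
        using norm_triangle_ineq4[of "X (Suc (r n)) t" "X (r n) t"] Xb[of "Suc (r n)" t] Xb[of "r n" t]
        by linarith
      then show ?thesis unfolding abs_power2 by (intro power_mono norm_ge_zero)
    qed
    then have "(\<lambda>n. integral {0..2 * pi} (?h n)) \<longlonglongrightarrow> integral {0..2 * pi} (\<lambda>t. (norm (z t - x t))\<^sup>2)"
      by (intro dominated_convergence_interval integrable_continuous_interval continuous_intros cont
          tendsto_intros xt zt)
    moreover have "(\<lambda>n. integral {0..2 * pi} (?h n)) \<longlonglongrightarrow> 0"
      using LIMSEQ_subseq_LIMSEQ[OF D r] by (simp add: o_def)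
    ultimately have int0: "integral {0..2 * pi} (\<lambda>t. (norm (z t - x t))\<^sup>2) = 0"
      using LIMSEQ_unique by blast
    have c: "continuous_on {0..2 * pi} (\<lambda>t. (norm (z t - x t))\<^sup>2)"
      by (intro continuous_intros continuous_on_subset[OF xcont] continuous_on_subset[OF zcont]) auto
    have "(norm (z s - x s))\<^sup>2 = 0" if "s \<in> {0..2 * pi}" for s
    proof (rule has_integral_0_cbox_imp_0[of 0 "2 * pi" "\<lambda>t. (norm (z t - x t))\<^sup>2"])
      show "((\<lambda>t. (norm (z t - x t))\<^sup>2) has_integral 0) (cbox 0 (2 * pi))"
        using integrable_integral[OF integrable_continuous_interval[OF c]] int0 by simp
      show "box 0 (2 * pi) \<noteq> {}" using pi_gt_zero by (simp add: not_le)
    qed (use c that in auto)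
    from this[OF periodic_reduce_range] show ?thesis
      using periodic_reduce[of z t, OF wz] periodic_reduce[of x t, OF wave_periodic[OF w]] by simp
  qed
  then have "z = x" ..
  with z zt have z: "uniform_limit UNIV (\<lambda>n. X (Suc (r n))) x sequentially"
    and zt: "(\<lambda>n. X (Suc (r n)) t) \<longlonglongrightarrow> x t" for t by simp_all
  have x': "(x has_vector_derivative y t) (at t)" for t
    using uniform_limit_has_vector_derivative[of "\<lambda>n. X (Suc (r n))" "\<lambda>n. Y (Suc (r n))" y x t] Xsol y zt
    by (simp add: linear_solution_def)
  have k_lim: "uniform_limit UNIV (\<lambda>n t. k (X (r n) t)) (\<lambda>t. k (x t)) sequentially"
  proof (rule uniform_limitI)
    fix e :: real assume "e > 0"
    then have "e / (2 * c) > 0" using c_pos by simp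
    from uniform_limitD[OF x this]
    show "\<forall>\<^sub>F n in sequentially. \<forall>t\<in>UNIV. dist (k (X (r n) t)) (k (x t)) < e"
    proof eventually_elim
      case (elim n)
      show ?case
      proof
        fix t
        have "dist (k (X (r n) t)) (k (x t)) \<le> 2 * c * dist (X (r n) t) (x t)"
          using k_lipschitz[OF Xb xb] by (simp add: dist_norm)
        also have "\<dots> < e" using elim c_pos by (simp add: field_simps)
        finally show "dist (k (X (r n) t)) (k (x t)) < e" .
      qed
    qed
  qed
  have "uniform_limit UNIV (\<lambda>n t. c *\<^sub>R X (Suc (r n)) t - k (X (r n) t)) (\<lambda>t. c *\<^sub>R x t - k (x t)) sequentially"
    by (intro uniform_limit_minus k_lim bounded_linear.uniform_limit[OF bounded_linear_scaleR_right z])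
  then have "uniform_limit UNIV (\<lambda>n t. c *\<^sub>R X (Suc (r n)) t - k (X (r n) t)) (\<lambda>t. f (x t)) sequentially"
    by (simp add: k_def)
  moreover have "(Y (Suc (r n)) has_vector_derivative c *\<^sub>R X (Suc (r n)) t - k (X (r n) t)) (at t)" for n t
    using Xsol[of "Suc (r n)"] Q[of "r n"] by (simp add: linear_solution_def)
  ultimately have y': "(y has_vector_derivative f (x t)) (at t)" for t
    by (intro uniform_limit_has_vector_derivative[where h = "\<lambda>n. Y (Suc (r n))"] yt) auto
  \<comment> \<open>Along a sequence tending to zero the integrals of \<open>H\<close> tend to 0,
    and with them the lower bounds of the actions, against the fixed negative upper bound.\<close>
  have "\<exists>t. x t \<noteq> 0"
  proof (rule ccontr)
    assume "\<nexists>t. x t \<noteq> 0"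
    then have x0: "x t = 0" for t by blast
    obtain B where "\<forall>u. norm u \<le> R \<longrightarrow> \<bar>H u\<bar> \<le> B" using H_bounded by blast
    then have B: "\<bar>H (X n t)\<bar> \<le> B" for n t using Xb by blast
    have "isCont H 0" using continuous_on_H[of UNIV] by (simp add: continuous_on_eq_continuous_at)
    then have "(\<lambda>n. H (X (r n) t)) \<longlonglongrightarrow> 0" for t
      using isCont_tendsto_compose[of 0 H] xt[of t] by (simp add: x0 H_def F_0)
    then have "(\<lambda>n. integral {0..2 * pi} (\<lambda>t. H (X (r n) t))) \<longlonglongrightarrow> integral {0..2 * pi} (\<lambda>t. 0)"
      by (intro dominated_convergence_interval[where B = B] B admissible_integrable(2)[OF X X])
    then have "(\<lambda>n. - integral {0..2 * pi} (\<lambda>t. H (X (r n) t))) \<longlonglongrightarrow> 0"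
      using tendsto_minus[of _ 0] by simp
    moreover have "- integral {0..2 * pi} (\<lambda>t. H (X (r n) t)) \<le> action x0 q0" for n
      using action_bounded_below[OF X] act order_trans by blast
    ultimately have "0 \<le> action x0 q0" by (intro LIMSEQ_le_const2) auto
    then show False using neg by simp
  qed
  then show ?thesis using that x' y' w by blast
qed

end

section \<open>Existence of antiperiodic solutions\<close>

text \<open>For |u| <= M it is enough that c M + B <= c R. On the annulus compactness gives u . f(u)
  >= d > 0, and expanding the square leaves c^2 R^2 - 2 c d + B^2, at most (c R)^2 once c >= B^2 /
  (2 d).\<close>

lemma invariant_ball_constant:
  fixes f :: "'a::euclidean_space \<Rightarrow> 'a"
  assumes lip: "L-lipschitz_on (cball 0 R) f" and M: "0 < M" "M < R"
    and pos: "\<And>u. M \<le> norm u \<Longrightarrow> u \<bullet> f u > 0"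
  shows "\<exists>c>0. L \<le> c \<and> (\<forall>u. norm u \<le> R \<longrightarrow> norm (c *\<^sub>R u - f u) \<le> c * R)"
proof -
  have cont: "continuous_on (cball 0 R) f" by (rule lipschitz_on_continuous_on[OF lip])
  then have "compact (f ` cball 0 R)" by (intro compact_continuous_image) auto
  then obtain B where "\<forall>v\<in>f ` cball 0 R. norm v \<le> B"
    using compact_imp_bounded bounded_iff by blast
  then have B: "norm (f u) \<le> B" if "norm u \<le> R" for u using that by simp
  have B_nonneg: "B \<ge> 0" using norm_ge_zero[of "f 0"] B[of 0] M by (simp del: norm_ge_zero)
  define A where "A = cball 0 R - ball (0::'a) M"
  have "\<exists>d>0. \<forall>u\<in>A. d \<le> u \<bullet> f u"
  proof (cases "A = {}")
    case False
    have "compact A" by (simp add: A_def compact_diff)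
    moreover have "continuous_on A (\<lambda>u. u \<bullet> f u)"
      by (intro continuous_intros continuous_on_subset[OF cont]) (auto simp: A_def)
    ultimately obtain u0 where "u0 \<in> A" "\<forall>u\<in>A. u0 \<bullet> f u0 \<le> u \<bullet> f u"
      using continuous_attains_inf False by blast
    then show ?thesis using pos[of u0] by (auto simp: A_def not_less)
  qed (auto intro: exI[of _ 1])
  then obtain d where d: "d > 0" "\<And>u. M \<le> norm u \<Longrightarrow> norm u \<le> R \<Longrightarrow> d \<le> u \<bullet> f u"
    by (auto simp: A_def not_less)
  define c where "c = max (max L 1) (max (B\<^sup>2 / (2 * d)) (B / (R - M)))"
  have c: "L \<le> c" "1 \<le> c" "B\<^sup>2 / (2 * d) \<le> c" "B / (R - M) \<le> c" by (auto simp: c_def)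
  have "norm (c *\<^sub>R u - f u) \<le> c * R" if u: "norm u \<le> R" for u
  proof (cases "norm u \<le> M")
    case True
    have "norm (c *\<^sub>R u - f u) \<le> norm (c *\<^sub>R u) + norm (f u)" by (rule norm_triangle_ineq4)
    also have "\<dots> \<le> c * M + B" using True c(2) B[OF u] by (intro add_mono) auto
    also have "\<dots> \<le> c * R" using c(4) M by (simp add: field_simps)
    finally show ?thesis .
  next
    case False
    have "(norm (c *\<^sub>R u - f u))\<^sup>2 = c\<^sup>2 * (norm u)\<^sup>2 - 2 * c * (u \<bullet> f u) + (norm (f u))\<^sup>2"
      unfolding power2_norm_eq_inner
      by (simp add: inner_diff_left inner_diff_right inner_commute power2_eq_square)
    also have "\<dots> \<le> c\<^sup>2 * R\<^sup>2 - 2 * c * d + B\<^sup>2"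
      using u B[OF u] B_nonneg c(2) d(2)[of u] False
      by (intro add_mono diff_mono mult_left_mono power_mono) auto
    also have "\<dots> \<le> (c * R)\<^sup>2" using c(3) d(1) by (simp add: field_simps power_mult_distrib)
    finally show ?thesis by (rule power2_le_imp_le) (use c(2) M in simp)
  qed
  then show ?thesis using c by (intro exI[of _ c]) auto
qed

lemma has_integral_cos_squared: "((\<lambda>t. (cos t)\<^sup>2) has_integral pi) {0..2 * pi}"
proof -
  have "((\<lambda>t. (cos t)\<^sup>2) has_integral ((2 * pi + sin (2 * pi) * cos (2 * pi)) / 2 - (0 + sin 0 * cos 0) / 2)) {0..2 * pi}"
  proof (rule fundamental_theorem_of_calculus)
    fix t :: real
    have "((\<lambda>t. (t + sin t * cos t) / 2) has_real_derivative (1 + (cos t * cos t - sin t * sin t)) / 2) (at t)"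
      by (auto intro!: derivative_eq_intros)
    moreover have "(1 + (cos t * cos t - sin t * sin t)) / 2 = (cos t)\<^sup>2"
      using sin_cos_squared_add[of t] by (simp add: power2_eq_square)
    ultimately show "((\<lambda>t. (t + sin t * cos t) / 2) has_vector_derivative (cos t)\<^sup>2) (at t within {0..2 * pi})"
      by (simp add: has_real_derivative_iff_has_vector_derivative has_vector_derivative_at_within)
  qed simp
  then show ?thesis by simp
qed

text \<open>For a small cosine wave along \<open>v\<close> the kinetic term has coefficient 1 and
  loses against a > 1 in \<open>F_le\<close>. Its action is negative, so the descent can start
  there.\<close>

theorem antiperiodic_solution:
  fixes f :: "'a::euclidean_space \<Rightarrow> 'a" and P :: "'a \<Rightarrow> 'a"
  assumes gradient: "\<And>u. (F has_derivative (\<lambda>h. f u \<bullet> h)) (at u)" and F_0: "F 0 = 0"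
    and f_odd: "\<And>u. f (- u) = - f u"
    and P_linear: "bounded_linear P" and f_P: "\<And>u. P u = u \<Longrightarrow> P (f u) = f u"
    and lip: "\<And>r. \<exists>L. L-lipschitz_on (cball 0 r) f"
    and M: "M > 0" "\<And>u. norm u > M \<Longrightarrow> u \<bullet> f u > 0"
    and v: "P v = v" "v \<noteq> 0"
    and a: "a > 1" and d: "d > 0"
    and F_le: "\<And>s. \<bar>s\<bar> \<le> d \<Longrightarrow> F (s *\<^sub>R v) \<le> - (a / 2) * s\<^sup>2 * (norm v)\<^sup>2"
  obtains x y where "\<And>t. (x has_vector_derivative y t) (at t)"
    "\<And>t. (y has_vector_derivative f (x t)) (at t)" "wave P x" "\<exists>t. x t \<noteq> 0"
proof -
  \<comment> \<open>The Nagumo inequality holds strictly outside radius \<open>M\<close>; it is used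
    on the closed annulus from M + 1 to M + 2.\<close>
  define R where "R = M + 2"
  obtain L where L: "L-lipschitz_on (cball 0 R) f" using lip by blast
  obtain c where c: "c > 0" "L \<le> c" "\<And>u. norm u \<le> R \<Longrightarrow> norm (c *\<^sub>R u - f u) \<le> c * R"
    using invariant_ball_constant[OF L, of "M + 1"] M by (auto simp: R_def)
  interpret gradient_system f F P R c
  proof (rule gradient_system.intro)
    show "norm (f u - f w) \<le> c * norm (u - w)" if "norm u \<le> R" "norm w \<le> R" for u w
      using lipschitz_onD[OF lipschitz_on_le[OF L c(2)], of u w] that by (simp add: dist_norm)
    show "R > 0" using M by (simp add: R_def)
  qed (fact gradient F_0 f_odd P_linear f_P c)+
  \<comment> \<open>The bound \<open>d\<close> puts the curve in the range of \<open>F_le\<close>;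
    the other one keeps the right-hand side below c R.\<close>
  define e where "e = min d (R * c / ((1 + c) * norm v))"
  have nv: "norm v > 0" using v by simp
  have e: "e > 0" "e \<le> d" using d R_pos c nv by (auto simp: e_def)
  have e_v: "(1 + c) * (e * norm v) \<le> c * R"
  proof -
    have "e \<le> R * c / ((1 + c) * norm v)" by (simp add: e_def)
    then have "e * ((1 + c) * norm v) \<le> R * c" using c nv by (subst (asm) pos_le_divide_eq) auto
    then show ?thesis by (simp add: mult_ac)
  qed
  \<comment> \<open>For a cosine -x'' = x, hence the factor 1 + c in the right-hand side.\<close>
  define x y q where "x t = (e * cos t) *\<^sub>R v" and "y t = - (e * sin t) *\<^sub>R v"
    and "q t = ((1 + c) * (e * cos t)) *\<^sub>R v" for t
  interpret P: bounded_linear P by (rule P_linear)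
  have lin: "linear_solution c x y q"
    unfolding linear_solution_def x_def y_def q_def
    by (auto intro!: derivative_eq_intros simp: algebra_simps)
  have w: "wave P x" by (simp add: wave_def x_def P.scaleR v)
  have cos_le: "\<bar>e * cos t\<bar> \<le> e" for t using e abs_cos_le_one[of t] by (simp add: abs_mult)
  have qb: "norm (q t) \<le> c * R" for t
  proof -
    have "norm (q t) = (1 + c) * (\<bar>e * cos t\<bar> * norm v)" using c by (simp add: q_def abs_mult)
    also have "\<dots> \<le> (1 + c) * (e * norm v)"
      using cos_le c by (intro mult_left_mono mult_right_mono) auto
    finally show ?thesis using e_v by simp
  qed
  have adm: "admissible x y q"
    unfolding admissible_def using lin w qb linear_solution_bound[OF lin w c(1) qb]
    by (auto simp: q_def intro!: continuous_intros)
  \<comment> \<open>The coefficient of |x|^2 in the integrand is at most (1 + c) / 2 - c / 2 - a / 2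
    = (1 - a) / 2.\<close>
  have "action x q \<le> integral {0..2 * pi} (\<lambda>t. (1 - a) / 2 * e\<^sup>2 * (norm v)\<^sup>2 * (cos t)\<^sup>2)"
    unfolding action_def
  proof (rule integral_le)
    show "(\<lambda>t. q t \<bullet> x t / 2 - H (x t)) integrable_on {0..2 * pi}"
      using admissible_integrable[OF adm adm] by (intro integrable_diff integrable_on_divide)
    show "(\<lambda>t. (1 - a) / 2 * e\<^sup>2 * (norm v)\<^sup>2 * (cos t)\<^sup>2) integrable_on {0..2 * pi}"
      by (intro integrable_continuous_interval continuous_intros)
    fix t
    have "F (x t) \<le> - (a / 2) * (e * cos t)\<^sup>2 * (norm v)\<^sup>2"
      unfolding x_def using cos_le[of t] e by (intro F_le) linarith
    moreover have "q t \<bullet> x t = (1 + c) * (e * cos t)\<^sup>2 * (norm v)\<^sup>2"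
      "x t \<bullet> x t = (e * cos t)\<^sup>2 * (norm v)\<^sup>2"
      by (simp_all add: q_def x_def power2_norm_eq_inner) (simp_all add: power2_eq_square mult_ac)
    ultimately show "q t \<bullet> x t / 2 - H (x t) \<le> (1 - a) / 2 * e\<^sup>2 * (norm v)\<^sup>2 * (cos t)\<^sup>2"
      by (simp add: H_def field_simps power_mult_distrib)
  qed
  also have "\<dots> = (1 - a) / 2 * e\<^sup>2 * (norm v)\<^sup>2 * pi"
    by (rule integral_unique, intro has_integral_mult_right has_integral_cos_squared)
  also have "\<dots> < 0"
    using a e nv by (intro mult_neg_pos mult_pos_pos) auto
  finally have "action x q < 0" .
  from critical_point_exists[OF adm this] that show ?thesis by blast
qed

section \<open>Isotropy groups\<close>

text \<open>The sign (-1)^l for an integer exponent, since translations go in both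
  directions.\<close>

definition alt :: "int \<Rightarrow> int" where "alt l = (if even l then 1 else - 1)"

lemma alt_minus: "alt (- a) = alt a"
  by (simp add: alt_def)

lemma alt_Z2: "alt l \<in> Z2"
  by (simp add: alt_def Z2_def)

section \<open>The group of translations that act by a sign\<close>

lemma translation_group_multiple:
  fixes x :: "real \<Rightarrow> 'a::real_vector"
  assumes "\<And>t. x (t + \<tau>) = of_int s *\<^sub>R x t" and s: "s \<in> Z2"
  shows "x (t + of_int n * \<tau>) = of_int (if even n then 1 else s) *\<^sub>R x t"
proof (induction n rule: int_induct[where k = 0])
  case (step1 i)
  then show ?case
    using assms(1)[of "t + of_int i * \<tau>"] s by (auto simp: Z2_def algebra_simps)
next
  case (step2 i)
  have "of_int s *\<^sub>R x (t + of_int (i - 1) * \<tau>) = of_int (if even i then 1 else s) *\<^sub>R x t"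
    using assms(1)[of "t + of_int (i - 1) * \<tau>"] step2 by (simp add: algebra_simps)
  then show ?case using s by (auto simp: Z2_def minus_equation_iff[of _ "x t"] split: if_splits)
qed simp

text \<open>Arbitrarily small positive elements of \<open>A\<close> would make the norm of
  \<open>x\<close> constant, equal to its value 0 at pi/2. So \<open>A\<close> has a least positive
  element, which generates it, and the sign -1 of pi makes pi an odd multiple of it.\<close>

lemma antiperiods:
  fixes x :: "real \<Rightarrow> 'a::real_normed_vector"
  assumes cont: "continuous_on UNIV x" and even: "\<And>t. x (- t) = x t"
    and anti: "\<And>t. x (t + pi) = - x t" and nz: "x t1 \<noteq> 0"
  shows "\<exists>m. \<forall>\<tau>. \<forall>s\<in>Z2. (\<forall>t. x (t + \<tau>) = of_int s *\<^sub>R x t) \<longleftrightarrow>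
    (\<exists>l::int. \<tau> = of_int l * (pi / real (2 * m + 1)) \<and> s = alt l)"
proof -
  define shift where "shift \<tau> s \<longleftrightarrow> s \<in> Z2 \<and> (\<forall>t. x (t + \<tau>) = of_int s *\<^sub>R x t)" for \<tau> and s :: int
  define A where "A = {\<tau>. \<exists>s. shift \<tau> s}"
  have pi_A: "shift pi (- 1)" using anti by (simp add: shift_def Z2_def)
  have half: "x (pi / 2) = 0"
  proof -
    have "x (pi / 2) = - x (pi / 2)" using anti[of "- (pi / 2)"] even[of "pi / 2"] by simp
    then show ?thesis by (simp add: eq_minus_self_iff)
  qed
  have mult: "shift (of_int n * \<tau>) (if even n then 1 else s)" if "shift \<tau> s" for n \<tau> s
    using translation_group_multiple[of x \<tau> s _ n] that by (auto simp: shift_def Z2_def)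
  have add: "shift (\<sigma> + \<tau>) (s * s')" if "shift \<sigma> s" "shift \<tau> s'" for \<sigma> \<tau> s s'
  proof -
    have "x (t + (\<sigma> + \<tau>)) = of_int (s * s') *\<^sub>R x t" for t
      using that by (simp add: shift_def mult.commute flip: add.assoc)
    then show ?thesis using that by (auto simp: shift_def Z2_def)
  qed
  have closed: "closed A"
  proof -
    have "A = (\<Inter>t. {\<tau>. x (t + \<tau>) = x t}) \<union> (\<Inter>t. {\<tau>. x (t + \<tau>) = - x t})"
      by (auto simp: A_def shift_def Z2_def)
    moreover have "closed {\<tau>. x (t + \<tau>) = b}" for t b
      by (intro closed_Collect_eq continuous_on_compose2[OF cont] continuous_intros) auto
    ultimately show ?thesis by auto
  qed
  have "\<exists>d>0. \<forall>\<tau>\<in>A. \<tau> > 0 \<longrightarrow> d \<le> \<tau>"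
  proof (rule ccontr)
    assume "\<not> ?thesis"
    then have small: "\<exists>\<tau>\<in>A. 0 < \<tau> \<and> \<tau> < d" if "d > 0" for d using that by (meson not_le)
    have "norm (x t) = norm (x (pi / 2))" for t
    proof (rule ccontr)
      assume ne: "norm (x t) \<noteq> norm (x (pi / 2))"
      have "isCont x t" using cont by (simp add: continuous_on_eq_continuous_at)
      then have "isCont (\<lambda>t. norm (x t)) t" by (intro continuous_intros)
      then obtain d where d: "d > 0" "\<And>u. dist u t < d \<Longrightarrow>
          dist (norm (x u)) (norm (x t)) < dist (norm (x (pi / 2))) (norm (x t))"
        using ne unfolding continuous_at_eps_delta by (metis zero_less_dist_iff)
      obtain \<tau> where \<tau>: "\<tau> \<in> A" "0 < \<tau>" "\<tau> < d" using small[OF d(1)] by blast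
      then obtain s where s: "shift \<tau> s" by (auto simp: A_def)
      \<comment> \<open>With this multiple of \<tau> the point pi/2 + n \<tau> lies within \<tau> of
        \<open>t\<close>, while the norm there is still the one at pi/2.\<close>
      define n where "n = \<lfloor>(t - pi / 2) / \<tau>\<rfloor>"
      have "of_int n \<le> (t - pi / 2) / \<tau>" "(t - pi / 2) / \<tau> < of_int n + 1"
        unfolding n_def by linarith+
      then have "of_int n * \<tau> \<le> t - pi / 2" "t - pi / 2 < of_int n * \<tau> + \<tau>"
        using \<tau>(2) by (simp_all add: field_simps)
      then have "dist (pi / 2 + of_int n * \<tau>) t < d" using \<tau>(3) by (simp add: dist_real_def)
      moreover have "norm (x (pi / 2 + of_int n * \<tau>)) = norm (x (pi / 2))"
        using mult[OF s, of n] by (auto simp: shift_def Z2_def)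
      ultimately show False using d(2) by fastforce
    qed
    then show False using nz half by simp
  qed
  then obtain d where d: "d > 0" "\<And>\<tau>. \<tau> \<in> A \<Longrightarrow> \<tau> > 0 \<Longrightarrow> d \<le> \<tau>" by blast
  \<comment> \<open>Every positive element of \<open>A\<close> is at least \<open>d\<close>, so the
    cut loses none of them and leaves a closed set whose infimum is attained.\<close>
  define T where "T = A \<inter> {d..}"
  have piT: "pi \<in> T" using d(2)[of pi] pi_A by (auto simp: T_def A_def)
  have bdd: "bdd_below T" by (rule bdd_belowI[of _ d]) (simp add: T_def)
  have "Inf T \<in> T"
    by (rule closed_contains_Inf) (use piT bdd closed in \<open>auto simp: T_def\<close>)
  moreover define \<tau>0 where "\<tau>0 = Inf T"
  ultimately have \<tau>0: "\<tau>0 \<in> A" "\<tau>0 > 0" using d(1) by (auto simp: T_def)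
  have min: "\<tau>0 \<le> \<tau>" if "\<tau> \<in> A" "\<tau> > 0" for \<tau>
    unfolding \<tau>0_def using that d(2) by (intro cInf_lower bdd) (simp add: T_def)
  obtain s0 where s0: "shift \<tau>0 s0" using \<tau>0 by (auto simp: A_def)
  \<comment> \<open>Division with remainder: a positive remainder would lie in \<open>A\<close>
    below its least positive element.\<close>
  have gen: "\<exists>l. \<tau> = of_int l * \<tau>0" if "shift \<tau> s" for \<tau> s
  proof -
    define l where "l = \<lfloor>\<tau> / \<tau>0\<rfloor>"
    have "of_int l \<le> \<tau> / \<tau>0" "\<tau> / \<tau>0 < of_int l + 1" unfolding l_def by linarith+
    then have r: "0 \<le> \<tau> - of_int l * \<tau>0" "\<tau> - of_int l * \<tau>0 < \<tau>0"
      using \<tau>0(2) by (simp_all add: field_simps)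
    have "\<tau> + of_int (- l) * \<tau>0 \<in> A" using add[OF that mult[OF s0, of "- l"]] unfolding A_def by blast
    then have "\<tau> - of_int l * \<tau>0 = 0" using r min[of "\<tau> - of_int l * \<tau>0"] by force
    then show ?thesis by auto
  qed
  have uniq: "s = s'" if "shift \<tau> s" "shift \<tau> s'" for \<tau> s s'
  proof -
    have "of_int s *\<^sub>R x t1 = (of_int s' :: real) *\<^sub>R x t1" using that by (metis shift_def)
    then show ?thesis using nz by simp
  qed
  obtain n where n: "pi = of_int n * \<tau>0" using gen[OF pi_A] by blast
  have "(if even n then 1 else s0) = - 1" using uniq[OF pi_A] mult[OF s0, of n] n by simp
  then have n_odd: "odd n" and s0: "shift \<tau>0 (- 1)" using s0 by (auto split: if_splits)
  have "of_int n * \<tau>0 > 0" using n pi_gt_zero by simp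
  then have "n > 0" using \<tau>0(2) by (simp add: zero_less_mult_iff)
  then obtain m where m: "n = int (2 * m + 1)"
    using n_odd by (metis nonneg_int_cases even_of_nat oddE less_imp_le)
  have \<tau>0_eq: "\<tau>0 = pi / real (2 * m + 1)" using n m by (simp add: field_simps)
  have alt_shift: "shift (of_int l * \<tau>0) (alt l)" for l
    using mult[OF s0, of l] by (simp add: alt_def)
  have "shift \<tau> s \<longleftrightarrow> (\<exists>l. \<tau> = of_int l * \<tau>0 \<and> s = alt l)" for \<tau> s
    using gen alt_shift uniq by blast
  then have "\<forall>\<tau>. \<forall>s\<in>Z2. (\<forall>t. x (t + \<tau>) = of_int s *\<^sub>R x t) \<longleftrightarrow>
      (\<exists>l::int. \<tau> = of_int l * (pi / real (2 * m + 1)) \<and> s = alt l)"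
    unfolding \<tau>0_eq shift_def by blast
  then show ?thesis by blast
qed

text \<open>The first column is a unit vector (cos, sin). Orthogonality makes the second one
  \<open>d\<close> times (- sin, cos), where \<open>d\<close> is the determinant and equals 1 or
  -1.\<close>

lemma orthogonal_matrix_2_cases:
  assumes "orthogonal_matrix (A :: real^2^2)"
  obtains \<tau> where "A = rot \<tau> \<or> A = rot \<tau> ** kappa"
proof -
  have "transpose A ** A = mat 1" using assms by (simp add: orthogonal_matrix)
  then have o: "A$1$1 * A$1$1 + A$2$1 * A$2$1 = 1" "A$1$1 * A$1$2 + A$2$1 * A$2$2 = 0"
    "A$1$2 * A$1$2 + A$2$2 * A$2$2 = 1"
    by (auto simp: mat2_simps)
  obtain \<tau> where t: "A$1$1 = cos \<tau>" "A$2$1 = sin \<tau>"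
    using sincos_total_2pi[of "A$1$1" "A$2$1"] o(1) by (auto simp: power2_eq_square)
  define d where "d = cos \<tau> * A$2$2 - sin \<tau> * A$1$2"
  have one: "sin \<tau> * sin \<tau> + cos \<tau> * cos \<tau> = 1"
    using sin_cos_squared_add[of \<tau>] by (simp only: power2_eq_square)
  have 1: "A$1$2 = - sin \<tau> * d" and 2: "A$2$2 = cos \<tau> * d"
    unfolding d_def using o(2)[unfolded t] one by algebra+
  have "d * d = 1" using o(3)[unfolded 1 2] one by algebra
  then have "d = 1 \<or> d = - 1" by (simp add: square_eq_1_iff)
  then have "A = rot \<tau> \<or> A = rot \<tau> ** kappa"
    using t 1 2 by (auto simp: mat2_simps)
  then show ?thesis using that by blast
qed

section \<open>From translations in time to isotropy groups\<close>

lemma rot_kappa_orthogonal: "orthogonal_matrix (rot \<tau> ** kappa)"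
  by (intro orthogonal_matrix_mul orthogonal_rot orthogonal_kappa)

text \<open>Rotation and sign depend only on \<open>l\<close> modulo 2 k, the modulus being even, so
  all integers may replace the finite range.\<close>

lemma dihedral_d_iff:
  assumes k: "k \<ge> 1"
  shows "(s, A) \<in> dihedral_d k \<longleftrightarrow> (\<exists>l::int. s = alt l \<and>
    (A = rot (of_int l * (pi / real k)) \<or> A = rot (of_int l * (pi / real k)) ** kappa))"
proof
  assume "(s, A) \<in> dihedral_d k"
  then obtain l where l: "s = (- 1) ^ l"
      "A = rot (real l * (pi / real k)) \<or> A = rot (real l * (pi / real k)) ** kappa"
    by (auto simp: dihedral_d_def)
  have "s = alt (int l)" using l(1) by (simp add: alt_def)
  then show "\<exists>l::int. s = alt l \<and> (A = rot (of_int l * (pi / real k)) \<or> A = rot (of_int l * (pi / real k)) ** kappa)"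
    using l(2) by (intro exI[of _ "int l"]) simp
next
  assume "\<exists>l::int. s = alt l \<and> (A = rot (of_int l * (pi / real k)) \<or> A = rot (of_int l * (pi / real k)) ** kappa)"
  then obtain l where l: "s = alt l"
    "A = rot (of_int l * (pi / real k)) \<or> A = rot (of_int l * (pi / real k)) ** kappa" by blast
  define j where "j = nat (l mod (2 * int k))"
  have j: "j < 2 * k" "l = int j + 2 * int k * (l div (2 * int k))"
    using k by (simp_all add: j_def nat_less_iff)
  have "s = alt (int j + 2 * int k * (l div (2 * int k)))"
    using l(1) arg_cong[OF j(2), of alt] by (rule trans)
  also have "\<dots> = (- 1) ^ j" by (simp add: alt_def)
  finally have s: "s = (- 1) ^ j" .
  have "rot (of_int l * (pi / real k)) = rot (real j * (pi / real k))"
    unfolding rot_eq_iff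
  proof (intro exI)
    have "real_of_int l = real j + 2 * real k * of_int (l div (2 * int k))"
      using arg_cong[OF j(2), of real_of_int] by simp
    then show "of_int l * (pi / real k) = real j * (pi / real k) + 2 * pi * of_int (l div (2 * int k))"
      using k by (simp add: field_simps)
  qed
  then show "(s, A) \<in> dihedral_d k" using l(2) s j(1) by (auto simp: dihedral_d_def)
qed

text \<open>As \<open>xi\<close> acts on the curve by the sign \<sigma>, a group element acts by a
  motion of time and one total sign. Evenness turns reflections into translations, so
  \<open>antiperiods\<close> decides both cases.\<close>

lemma isotropy_group_scalar:
  assumes cont: "continuous_on UNIV x" and even: "\<And>t. x (- t) = x t"
    and anti: "\<And>t. x (t + pi) = - x t" and nz: "x t1 \<noteq> 0"
    and xi: "\<And>t. xi (x t) = of_int \<sigma> *\<^sub>R x t" and \<sigma>: "\<sigma> \<in> Z2"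
  shows "\<exists>m. isotropy_group x = {(\<gamma>, s, A). \<gamma> \<in> Z2 \<and> s \<in> Z2 \<and>
    (s * (if \<gamma> = 1 then 1 else \<sigma>), A) \<in> dihedral_d (2 * m + 1)}"
proof -
  obtain m where m: "\<And>\<tau> s. s \<in> Z2 \<Longrightarrow> (\<forall>t. x (t + \<tau>) = of_int s *\<^sub>R x t) \<longleftrightarrow>
    (\<exists>l::int. \<tau> = of_int l * (pi / real (2 * m + 1)) \<and> s = alt l)"
    using antiperiods[OF cont even anti nz] by blast
  have per: "x (t + 2 * pi) = x t" for t
    using anti[of "t + pi"] anti[of t] by (simp add: add.assoc)
  have k: "2 * m + 1 \<ge> 1" by simp
  define c where "c \<gamma> = (if \<gamma> = 1 then 1 else \<sigma>)" for \<gamma> :: int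
  have c: "s * c \<gamma> \<in> Z2" if "s \<in> Z2" for s \<gamma> using that \<sigma> by (auto simp: c_def Z2_def)
  have act_c: "of_int s *\<^sub>R Gamma_act \<gamma> (x u) = of_int (s * c \<gamma>) *\<^sub>R x u" for s \<gamma> u
    by (simp add: Gamma_act_def c_def xi)
  have flip: "of_int r *\<^sub>R v = w \<longleftrightarrow> v = of_int r *\<^sub>R w" if "r \<in> Z2" for r and v w :: "real^4"
    using that by (auto simp: Z2_def)
  have R: "act (\<gamma>, s, rot \<tau>) x = x \<longleftrightarrow>
      (\<exists>l::int. \<tau> = of_int l * (pi / real (2 * m + 1)) \<and> s * c \<gamma> = alt l)"
    if "s \<in> Z2" for \<gamma> s \<tau>
    unfolding fun_eq_iff act_rot[where x = x, OF per] act_c flip[OF c[OF that]] m[OF c[OF that]] ..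
  have S: "act (\<gamma>, s, rot \<tau> ** kappa) x = x \<longleftrightarrow>
      (\<exists>l::int. \<tau> = of_int l * (pi / real (2 * m + 1)) \<and> s * c \<gamma> = alt l)"
    if "s \<in> Z2" for \<gamma> s \<tau>
  proof -
    \<comment> \<open>The reflection amounts to translation by - \<tau>; passing from
      \<open>l\<close> to \<open>- l\<close> restores \<tau> and leaves \<open>alt l\<close>
      unchanged.\<close>
    have ex_minus: "(\<exists>l. Q l) \<longleftrightarrow> (\<exists>l. Q (- l))" for Q :: "int \<Rightarrow> bool" by (metis minus_minus)
    have "x (- t + \<tau>) = x (t + - \<tau>)" for t using even[of "t + - \<tau>"] by simp
    then have "act (\<gamma>, s, rot \<tau> ** kappa) x = x \<longleftrightarrow>
      (\<exists>l::int. - \<tau> = of_int l * (pi / real (2 * m + 1)) \<and> s * c \<gamma> = alt l)"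
      unfolding fun_eq_iff act_rot_kappa[where x = x, OF per] act_c flip[OF c[OF that]] m[OF c[OF that], symmetric]
      by simp
    also have "\<dots> \<longleftrightarrow> (\<exists>l::int. \<tau> = of_int l * (pi / real (2 * m + 1)) \<and> s * c \<gamma> = alt l)"
      by (subst ex_minus) (simp add: alt_minus)
    finally show ?thesis .
  qed
  have "(\<gamma>, s, A) \<in> isotropy_group x \<longleftrightarrow> (s * c \<gamma>, A) \<in> dihedral_d (2 * m + 1)"
    if Z: "\<gamma> \<in> Z2" "s \<in> Z2" for \<gamma> s A
  proof
    assume "(\<gamma>, s, A) \<in> isotropy_group x"
    then have *: "act (\<gamma>, s, A) x = x" "orthogonal_matrix A"
      by (simp_all add: isotropy_group_def G_carrier_def O2_def)
    obtain \<tau> where \<tau>: "A = rot \<tau> \<or> A = rot \<tau> ** kappa" using orthogonal_matrix_2_cases[OF *(2)] .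
    then have "\<exists>l::int. \<tau> = of_int l * (pi / real (2 * m + 1)) \<and> s * c \<gamma> = alt l"
      using R[OF Z(2), of \<gamma> \<tau>] S[OF Z(2), of \<gamma> \<tau>] *(1) by auto
    then show "(s * c \<gamma>, A) \<in> dihedral_d (2 * m + 1)"
      unfolding dihedral_d_iff[OF k] using \<tau> by blast
  next
    assume "(s * c \<gamma>, A) \<in> dihedral_d (2 * m + 1)"
    then obtain l :: int where l: "s * c \<gamma> = alt l"
      "A = rot (of_int l * (pi / real (2 * m + 1))) \<or> A = rot (of_int l * (pi / real (2 * m + 1))) ** kappa"
      unfolding dihedral_d_iff[OF k] by blast
    define \<tau> where "\<tau> = of_int l * (pi / real (2 * m + 1))"
    have "act (\<gamma>, s, rot \<tau>) x = x" "act (\<gamma>, s, rot \<tau> ** kappa) x = x"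
      unfolding R[OF Z(2)] S[OF Z(2)] \<tau>_def using l(1) by blast+
    then have "act (\<gamma>, s, A) x = x" using l(2)[folded \<tau>_def] by auto
    moreover have "orthogonal_matrix A" using l(2) orthogonal_rot rot_kappa_orthogonal by metis
    ultimately show "(\<gamma>, s, A) \<in> isotropy_group x"
      using Z by (simp add: isotropy_group_def G_carrier_def O2_def)
  qed
  moreover have "\<gamma> \<in> Z2 \<and> s \<in> Z2" if "(\<gamma>, s, A) \<in> isotropy_group x" for \<gamma> s A
    using that by (simp add: isotropy_group_def G_carrier_def)
  ultimately have iff: "(\<gamma>, s, A) \<in> isotropy_group x \<longleftrightarrow>
      \<gamma> \<in> Z2 \<and> s \<in> Z2 \<and> (s * c \<gamma>, A) \<in> dihedral_d (2 * m + 1)" for \<gamma> s A by blast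
  have "isotropy_group x = {(\<gamma>, s, A). \<gamma> \<in> Z2 \<and> s \<in> Z2 \<and> (s * c \<gamma>, A) \<in> dihedral_d (2 * m + 1)}"
    by (simp only: set_eq_iff split_paired_All iff mem_Collect_eq case_prod_conv simp_thms)
  then show ?thesis unfolding c_def by blast
qed

text \<open>On \<open>V4\<close> the map \<open>phi\<close> is the product of the two signs, and
  \<open>psi\<close> is the parity sign of the rotation index. The fibre condition becomes
  \<open>s * \<gamma> = alt l\<close>, the form in which isotropy groups are computed.\<close>

lemma V4_amalgam_dihedral_eq:
  assumes k: "k \<ge> 1"
  shows "V4_amalgam_dihedral k = {(\<gamma>, s, A). \<gamma> \<in> Z2 \<and> s \<in> Z2 \<and> (s * \<gamma>, A) \<in> dihedral_d k}"
proof -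
  have angle: "of_int l * (2 * pi / real (2 * k)) = of_int l * (pi / real k)" for l :: int by simp
  have psi: "psi k A = alt l"
    if "A = rot (of_int l * (pi / real k)) \<or> A = rot (of_int l * (pi / real k)) ** kappa" for l :: int and A
    using that rot_in_dihedral[OF k, of l] unfolding angle
    by (auto simp: psi_def rot_kappa_in_dihedral alt_def)
  have phi: "phi (\<gamma>, s) = s * \<gamma>" if "\<gamma> \<in> Z2" "s \<in> Z2" for \<gamma> s
    using that by (auto simp: phi_def Z2_minus_def Z2_def)
  have dih: "A \<in> dihedral (2 * k) \<longleftrightarrow>
      (\<exists>l::int. A = rot (of_int l * (pi / real k)) \<or> A = rot (of_int l * (pi / real k)) ** kappa)" for A
    unfolding dihedral_eq angle by blast
  have "A \<in> dihedral (2 * k) \<and> s = psi k A \<longleftrightarrow> (s, A) \<in> dihedral_d k" for s A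
    unfolding dih dihedral_d_iff[OF k] using psi by metis
  then show ?thesis
    unfolding V4_amalgam_dihedral_def V4_def using phi by auto
qed

text \<open>Here \<open>xi\<close> acts by the sign 1, so \<gamma> is unconstrained and splits off
  as a direct factor.\<close>

lemma isotropy_group_symmetric:
  assumes "continuous_on UNIV x" "wave xi x" "x t1 \<noteq> 0"
  shows "\<exists>m. isotropy_group x = Z2_times_dihedral_d (2 * m + 1)"
proof -
  have "\<exists>m. isotropy_group x = {(\<gamma>, s, A). \<gamma> \<in> Z2 \<and> s \<in> Z2 \<and>
      (s * (if \<gamma> = 1 then 1 else 1), A) \<in> dihedral_d (2 * m + 1)}"
    by (rule isotropy_group_scalar[OF assms(1) _ _ assms(3)]) (use assms(2) in \<open>auto simp: wave_def Z2_def\<close>)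
  then obtain m where m: "isotropy_group x = {(\<gamma>, s, A). \<gamma> \<in> Z2 \<and> s \<in> Z2 \<and>
      (s, A) \<in> dihedral_d (2 * m + 1)}" by auto
  have "s \<in> Z2" if "(s, A) \<in> dihedral_d (2 * m + 1)" for s A
    using that dihedral_d_iff[of "2 * m + 1"] alt_Z2 by auto
  then have "isotropy_group x = Z2_times_dihedral_d (2 * m + 1)"
    unfolding m Z2_times_dihedral_d_def by auto
  then show ?thesis ..
qed

text \<open>Here \<open>xi\<close> acts by the sign -1, so the factor contributed by \<gamma> is
  \<gamma> itself.\<close>

lemma isotropy_group_antisymmetric:
  assumes "continuous_on UNIV x" "wave (\<lambda>u. - xi u) x" "x t1 \<noteq> 0"
  shows "\<exists>m. isotropy_group x = V4_amalgam_dihedral (2 * m + 1)"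
proof -
  have "- xi (x t) = x t" for t using assms(2) by (simp add: wave_def)
  then have "xi (x t) = - x t" for t by (metis minus_minus)
  then have "\<exists>m. isotropy_group x = {(\<gamma>, s, A). \<gamma> \<in> Z2 \<and> s \<in> Z2 \<and>
      (s * (if \<gamma> = 1 then 1 else - 1), A) \<in> dihedral_d (2 * m + 1)}"
    by (intro isotropy_group_scalar[OF assms(1) _ _ assms(3)]) (use assms(2) in \<open>auto simp: wave_def Z2_def\<close>)
  then obtain m where m: "isotropy_group x = {(\<gamma>, s, A). \<gamma> \<in> Z2 \<and> s \<in> Z2 \<and>
      (s * (if \<gamma> = 1 then 1 else - 1), A) \<in> dihedral_d (2 * m + 1)}" by blast
  have k: "2 * m + 1 \<ge> 1" by simp
  have "(if \<gamma> = 1 then 1 else - 1) = \<gamma>" if "\<gamma> \<in> Z2" for \<gamma> :: int using that by (auto simp: Z2_def)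
  then have "isotropy_group x = V4_amalgam_dihedral (2 * m + 1)"
    unfolding m V4_amalgam_dihedral_eq[OF k] by auto
  then show ?thesis ..
qed

section \<open>The network\<close>

lemma vector_4:
  "vector [a, b, c, d] $ (1 :: 4) = a" "vector [a, b, c, d] $ (2 :: 4) = b"
  "vector [a, b, c, d] $ (3 :: 4) = c" "vector [a, b, c, d] $ (4 :: 4) = d"
  by (simp_all add: vector_def)

lemma Delta_G_nth:
  "(Delta_G *v u) $ 1 = - u $ 1 + u $ 2" "(Delta_G *v u) $ 2 = u $ 1 - 2 * u $ 2 + u $ 3"
  "(Delta_G *v u) $ 3 = u $ 2 - 2 * u $ 3 + u $ 4" "(Delta_G *v u) $ 4 = u $ 3 - u $ 4"
  by (simp_all add: Delta_G_def matrix_vector_mult_def sum_4 vector_4)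

lemma xi_nth: "xi u $ 1 = u $ 4" "xi u $ 2 = u $ 3" "xi u $ 3 = u $ 2" "xi u $ 4 = u $ 1"
  by (simp_all add: xi_def vector_4)

lemma inner_4: "(u :: real^4) \<bullet> w = u $ 1 * w $ 1 + u $ 2 * w $ 2 + u $ 3 * w $ 3 + u $ 4 * w $ 4"
  by (simp add: inner_vec_def sum_4)

lemma vec_4_eq_iff: "(u :: 'a^4) = w \<longleftrightarrow> u $ 1 = w $ 1 \<and> u $ 2 = w $ 2 \<and> u $ 3 = w $ 3 \<and> u $ 4 = w $ 4"
  by (simp add: vec_eq_iff forall_4)

lemma Delta_G_symmetric: "(Delta_G *v u) \<bullet> w = u \<bullet> (Delta_G *v w)"
  by (simp add: inner_4 Delta_G_nth algebra_simps)

lemma bounded_linear_xi: "bounded_linear xi"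
  by (intro linear_conv_bounded_linear[THEN iffD1] linearI) (simp_all add: vec_4_eq_iff xi_nth)

lemma network_field_xi: "network_field g (xi u) = xi (network_field g u)"
  by (simp add: vec_4_eq_iff network_field_def xi_nth Delta_G_nth algebra_simps)

lemma network_field_minus:
  assumes "\<forall>s. g (- s) = - g s"
  shows "network_field g (- u) = - network_field g u"
  by (simp add: vec_4_eq_iff network_field_def Delta_G_nth assms algebra_simps)

text \<open>A continuous derivative is bounded on a compact interval. The factor 4 counts
  coordinates, as the Euclidean norm is estimated by the sum of their moduli.\<close>

lemma network_field_lipschitz:
  assumes "g C1_differentiable_on UNIV"
  shows "\<exists>L. L-lipschitz_on (cball 0 r) (network_field g)"
proof -
  obtain D where D: "\<And>s. (g has_vector_derivative D s) (at s)" "continuous_on UNIV D"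
    using assms by (auto simp: C1_differentiable_on_def)
  have "compact (D ` {- r..r})"
    by (intro compact_continuous_image continuous_on_subset[OF D(2)]) auto
  then obtain B where "\<forall>d\<in>D ` {- r..r}. norm d \<le> B" using compact_imp_bounded bounded_iff by blast
  then have B: "\<bar>D s\<bar> \<le> \<bar>B\<bar>" if "s \<in> {- r..r}" for s
    using that unfolding real_norm_def by (meson abs_ge_self image_eqI order_trans)
  have g_lip: "\<bar>g s - g t\<bar> \<le> \<bar>B\<bar> * \<bar>s - t\<bar>" if "s \<in> {- r..r}" "t \<in> {- r..r}" for s t
  proof -
    have "norm (g s - g t) \<le> \<bar>B\<bar> * norm (s - t)"
    proof (rule field_differentiable_bound[of "{- r..r}" g D])
      show "(g has_real_derivative D s) (at s within {- r..r})" for s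
        using D(1) by (simp add: has_real_derivative_iff_has_vector_derivative has_vector_derivative_at_within)
      show "norm (D s) \<le> \<bar>B\<bar>" if "s \<in> {- r..r}" for s using B[OF that] by simp
    qed (use that in auto)
    then show ?thesis by simp
  qed
  obtain K where K: "K \<ge> 0" "\<And>u. norm (Delta_G *v u) \<le> norm u * K"
    using bounded_linear.nonneg_bounded[OF matrix_vector_mul_bounded_linear] by blast
  have "(K + 4 * \<bar>B\<bar>)-lipschitz_on (cball 0 r) (network_field g)"
  proof (rule lipschitz_onI)
    fix u w :: "real^4" assume uw: "u \<in> cball 0 r" "w \<in> cball 0 r"
    have comp: "\<bar>u $ i\<bar> \<le> r" "\<bar>w $ i\<bar> \<le> r" for i
      using uw component_le_norm_cart[of u i] component_le_norm_cart[of w i] by auto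
    have "\<bar>g (u $ i) - g (w $ i)\<bar> \<le> \<bar>B\<bar> * norm (u - w)" for i
    proof -
      have "\<bar>g (u $ i) - g (w $ i)\<bar> \<le> \<bar>B\<bar> * \<bar>(u - w) $ i\<bar>"
        using g_lip[of "u $ i" "w $ i"] comp[of i] by (simp add: abs_le_iff)
      also have "\<dots> \<le> \<bar>B\<bar> * norm (u - w)" by (intro mult_left_mono component_le_norm_cart) auto
      finally show ?thesis .
    qed
    then have "(\<Sum>i\<in>UNIV. \<bar>g (u $ i) - g (w $ i)\<bar>) \<le> of_nat (card (UNIV :: 4 set)) * (\<bar>B\<bar> * norm (u - w))"
      by (intro sum_bounded_above)
    then have "norm (\<chi> i. g (u $ i) - g (w $ i)) \<le> 4 * (\<bar>B\<bar> * norm (u - w))"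
      using norm_le_l1_cart[of "\<chi> i. g (u $ i) - g (w $ i)"] by simp
    moreover have "network_field g u - network_field g w =
        Delta_G *v (u - w) + (\<chi> i. g (u $ i) - g (w $ i))"
      by (simp add: network_field_def matrix_vector_mult_diff_distrib vec_eq_iff)
    moreover have "(K + 4 * \<bar>B\<bar>) * norm (u - w) = norm (u - w) * K + 4 * (\<bar>B\<bar> * norm (u - w))"
      by (simp only: distrib_right mult.commute[of K] mult.assoc)
    ultimately show "dist (network_field g u) (network_field g w) \<le> (K + 4 * \<bar>B\<bar>) * dist u w"
      using norm_triangle_ineq[of "Delta_G *v (u - w)" "\<chi> i. g (u $ i) - g (w $ i)"] K(2)[of "u - w"]
      unfolding dist_norm by (simp del: matrix_vector_mult_diff_distrib)
  qed (use K in auto)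
  then show ?thesis by blast
qed

text \<open>The potential is lambda^2 times half the quadratic form of \<open>Delta_G\<close> plus
  the sum of G(u_i). Along the eigenvector its quadratic part beats the kinetic term because lambda
  omega > 1, and \<open>G\<close> is of smaller order since g(0) = g'(0) = 0.\<close>

theorem network_wave_exists:
  fixes g :: "real \<Rightarrow> real" and P :: "real^4 \<Rightarrow> real^4"
  assumes g_odd: "\<forall>s. g (- s) = - g s" and g_C1: "g C1_differentiable_on UNIV" and g0: "deriv g 0 = 0"
    and M: "M > 0" "\<forall>u. norm u > M \<longrightarrow> u \<bullet> network_field g u > 0"
    and P: "bounded_linear P" "\<And>u. network_field g (P u) = P (network_field g u)"
    and v: "P v = v" "v \<noteq> 0" "Delta_G *v v = - \<omega>\<^sup>2 *\<^sub>R v"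
    and \<omega>: "\<omega> > 0" "lambda > 1 / \<omega>"
  obtains x y where "\<And>t. (x has_vector_derivative y t) (at t)"
    "\<And>t. (y has_vector_derivative lambda\<^sup>2 *\<^sub>R network_field g (x t)) (at t)" "wave P x" "\<exists>t. x t \<noteq> 0"
proof -
  have "1 / \<omega> > 0" using \<omega>(1) by simp
  then have l: "lambda > 0" using \<omega>(2) by linarith
  have "1 < lambda * \<omega>" using \<omega> by (simp add: field_simps)
  then have l\<omega>: "1 < lambda\<^sup>2 * \<omega>\<^sup>2" using one_less_power[of "lambda * \<omega>" 2] by (simp add: power_mult_distrib)
  obtain D where D: "\<And>s. (g has_vector_derivative D s) (at s)" "continuous_on UNIV D"
    using g_C1 by (auto simp: C1_differentiable_on_def)
  then have gD: "(g has_real_derivative D s) (at s)" for s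
    by (simp add: has_real_derivative_iff_has_vector_derivative)
  have g_cont: "continuous_on UNIV g"
    using gD DERIV_isCont continuous_at_imp_continuous_on by blast
  obtain G where "\<forall>s. (G has_vector_derivative g s) (at s)" and G0: "G 0 = 0"
    using antiderivative_exists[OF g_cont] by blast
  then have G: "(G has_real_derivative g s) (at s)" for s
    by (simp add: has_real_derivative_iff_has_vector_derivative)
  \<comment> \<open>With this choice lambda^2 (omega^2 - 2 \<eta>) is the constant \<open>a\<close>
    below, the midpoint of 1 and lambda^2 omega^2.\<close>
  define \<eta> where "\<eta> = (\<omega>\<^sup>2 - 1 / lambda\<^sup>2) / 4"
  have \<eta>: "\<eta> > 0" using l\<omega> l by (simp add: \<eta>_def field_simps)
  have gz: "g 0 = 0" using g_odd[rule_format, of 0] by simp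
  have "(g has_real_derivative 0) (at 0)" using gD[of 0] DERIV_imp_deriv[OF gD[of 0]] g0 by simp
  then have "((\<lambda>h. g h / h) \<longlongrightarrow> 0) (at 0)" by (simp add: DERIV_def gz)
  then obtain \<rho> where \<rho>: "\<rho> > 0" "\<And>s. s \<noteq> 0 \<Longrightarrow> \<bar>s\<bar> < \<rho> \<Longrightarrow> \<bar>g s / s\<bar> < \<eta>"
    using \<eta> unfolding LIM_def by (auto simp: dist_real_def)
  have g_small: "\<bar>g s\<bar> \<le> \<eta> * \<bar>s\<bar>" if "\<bar>s\<bar> < \<rho>" for s
    using \<rho>(2)[OF _ that] by (cases "s = 0") (auto simp: gz field_simps abs_divide)
  have G_small: "\<bar>G s\<bar> \<le> \<eta> * s\<^sup>2" if "\<bar>s\<bar> < \<rho>" for s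
  proof -
    have "norm (G s - G 0) \<le> (\<eta> * \<bar>s\<bar>) * norm (s - 0)"
    proof (rule field_differentiable_bound[of "{- \<bar>s\<bar>..\<bar>s\<bar>}" G g])
      show "(G has_real_derivative g r) (at r within {- \<bar>s\<bar>..\<bar>s\<bar>})" for r
        using G[of r] by (rule has_field_derivative_at_within)
      show "norm (g r) \<le> \<eta> * \<bar>s\<bar>" if r: "r \<in> {- \<bar>s\<bar>..\<bar>s\<bar>}" for r
      proof -
        have "\<bar>r\<bar> \<le> \<bar>s\<bar>" using r by auto
        then show ?thesis
          using g_small[of r] \<open>\<bar>s\<bar> < \<rho>\<close> mult_left_mono[of "\<bar>r\<bar>" "\<bar>s\<bar>" \<eta>] \<eta>
          unfolding real_norm_def by linarith
      qed
    qed auto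
    then show ?thesis by (simp add: G0 power2_eq_square mult.assoc)
  qed
  define F where "F u = lambda\<^sup>2 * ((u \<bullet> (Delta_G *v u)) / 2 + (\<Sum>i\<in>UNIV. G (u $ i)))" for u :: "real^4"
  define f where "f u = lambda\<^sup>2 *\<^sub>R network_field g u" for u
  interpret P: bounded_linear P by (rule P)
  have grad: "(F has_derivative (\<lambda>h. f u \<bullet> h)) (at u)" for u
  proof -
    have 1: "((\<lambda>u. Delta_G *v u) has_derivative (\<lambda>h. Delta_G *v h)) (at u)"
      by (intro bounded_linear_imp_has_derivative matrix_vector_mul_bounded_linear)
    have 2: "((\<lambda>u. u \<bullet> (Delta_G *v u)) has_derivative (\<lambda>h. u \<bullet> (Delta_G *v h) + h \<bullet> (Delta_G *v u))) (at u)"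
      by (rule has_derivative_inner[OF has_derivative_ident 1])
    have 3: "((\<lambda>u. G (u $ i)) has_derivative (\<lambda>h. g (u $ i) * h $ i)) (at u)" for i
      using has_derivative_compose[OF bounded_linear_imp_has_derivative[OF bounded_linear_vec_nth[of i]]
          G[of "u $ i", unfolded has_field_derivative_def]] .
    have "(F has_derivative (\<lambda>h. lambda\<^sup>2 * ((u \<bullet> (Delta_G *v h) + h \<bullet> (Delta_G *v u)) / 2
        + (\<Sum>i\<in>UNIV. g (u $ i) * h $ i)))) (at u)"
      unfolding F_def by (auto intro!: derivative_eq_intros 1 2 3)
    moreover have "lambda\<^sup>2 * ((u \<bullet> (Delta_G *v h) + h \<bullet> (Delta_G *v u)) / 2
        + (\<Sum>i\<in>UNIV. g (u $ i) * h $ i)) = f u \<bullet> h" for h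
    proof -
      have "u \<bullet> (Delta_G *v h) = (Delta_G *v u) \<bullet> h" "h \<bullet> (Delta_G *v u) = (Delta_G *v u) \<bullet> h"
        by (simp only: Delta_G_symmetric) (rule inner_commute)
      moreover have "(\<Sum>i\<in>UNIV. g (u $ i) * h $ i) = (\<chi> i. g (u $ i)) \<bullet> h"
        by (simp add: inner_vec_def)
      ultimately show ?thesis by (simp add: f_def network_field_def inner_add_left)
    qed
    ultimately show ?thesis by simp
  qed
  define a where "a = (lambda\<^sup>2 * \<omega>\<^sup>2 + 1) / 2"
  \<comment> \<open>The coordinates of s v then have modulus at most \<rho> / 2, in the range of
    \<open>G_small\<close>.\<close>
  define d where "d = \<rho> / (2 * norm v)"
  have F_le: "F (s *\<^sub>R v) \<le> - (a / 2) * s\<^sup>2 * (norm v)\<^sup>2" if s: "\<bar>s\<bar> \<le> d" for s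
  proof -
    have "\<bar>s\<bar> * norm v \<le> \<rho> / 2" using s v(2) by (simp add: d_def field_simps)
    then have small: "\<bar>s * v $ i\<bar> < \<rho>" for i
      using mult_left_mono[OF component_le_norm_cart[of v i], of "\<bar>s\<bar>"] \<rho>(1) by (simp add: abs_mult)
    have "(\<Sum>i\<in>UNIV. G (s * v $ i)) \<le> (\<Sum>i\<in>UNIV. \<eta> * (s * v $ i)\<^sup>2)"
      using G_small[OF small] by (intro sum_mono) (simp add: abs_le_iff)
    also have "\<dots> = \<eta> * s\<^sup>2 * (norm v)\<^sup>2"
      unfolding power2_norm_eq_inner inner_vec_def
      by (simp add: power2_eq_square sum_distrib_left mult_ac)
    finally have "(\<Sum>i\<in>UNIV. G (s * v $ i)) \<le> \<eta> * s\<^sup>2 * (norm v)\<^sup>2" .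
    moreover have "(s *\<^sub>R v) \<bullet> (Delta_G *v (s *\<^sub>R v)) = - (\<omega>\<^sup>2 * s\<^sup>2 * (norm v)\<^sup>2)"
      unfolding power2_norm_eq_inner
      by (simp add: matrix_vector_mult_scaleR v(3) power2_eq_square mult_ac)
    ultimately have "F (s *\<^sub>R v) \<le> lambda\<^sup>2 * (- (\<omega>\<^sup>2 * s\<^sup>2 * (norm v)\<^sup>2) / 2 + \<eta> * s\<^sup>2 * (norm v)\<^sup>2)"
      unfolding F_def by (intro mult_left_mono add_mono) simp_all
    also have "\<dots> = - (a / 2) * s\<^sup>2 * (norm v)\<^sup>2"
      using l by (simp add: a_def \<eta>_def field_simps)
    finally show ?thesis .
  qed
  show ?thesis
  proof (rule antiperiodic_solution[of F f P M v a d])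
    show "\<exists>L. L-lipschitz_on (cball 0 r) f" for r
      using network_field_lipschitz[OF g_C1, of r] lipschitz_on_cmult unfolding f_def by blast
    show "F 0 = 0" by (simp add: F_def G0)
    show "f (- u) = - f u" for u by (simp add: f_def network_field_minus[OF g_odd])
    show "P (f u) = f u" if "P u = u" for u using that P(2)[of u] by (simp add: f_def P.scaleR)
    show "u \<bullet> f u > 0" if "norm u > M" for u using M(2) that l by (simp add: f_def)
    show "a > 1" using l\<omega> by (simp add: a_def)
    show "d > 0" using \<rho> v by (simp add: d_def)
  qed (fact grad P(1) M(1) v(1,2) F_le that[folded f_def])+
qed

section \<open>Sign change and rescaling of time\<close>

lemma isotropy_group_minus: "isotropy_group (\<lambda>t. - x t) = isotropy_group x"
proof -
  have "Gamma_act \<gamma> (- u) = - Gamma_act \<gamma> u" for \<gamma> u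
    by (simp add: Gamma_act_def linear_neg[OF bounded_linear.linear[OF bounded_linear_xi]])
  then have "act h (\<lambda>t. - x t) t = - act h x t" for h t
    by (cases h) (simp add: act_def)
  then show ?thesis by (auto simp: isotropy_group_def fun_eq_iff)
qed

lemma periodic_solution_minus:
  assumes "periodic_solution f p u" and "\<And>w. f (- w) = - f w"
  shows "periodic_solution f p (\<lambda>t. - u t)"
proof -
  obtain v where v: "\<And>t. (u has_vector_derivative v t) (at t)"
    "\<And>t. (v has_vector_derivative f (u t)) (at t)" "\<And>t. u t = u (t + p)" "\<And>t. v t = v (t + p)"
    using assms(1) unfolding periodic_solution_def by blast
  show ?thesis
    unfolding periodic_solution_def
    by (intro exI[of _ "\<lambda>t. - v t"] conjI allI)
      (use v(3,4) has_vector_derivative_minus[OF v(1)] has_vector_derivative_minus[OF v(2)] assms(2)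
        in simp_all)
qed

text \<open>Two derivatives of \<open>x (t / lambda)\<close> bring in 1 / lambda^2, which cancels
  the factor in the equation, and the period 2 pi becomes \<open>p\<close>.\<close>

lemma periodic_solution_from_wave:
  assumes x: "\<And>t. (x has_vector_derivative y t) (at t)"
    and y: "\<And>t. (y has_vector_derivative lambda\<^sup>2 *\<^sub>R f (x t)) (at t)"
    and w: "wave P x" and lambda: "lambda > 0" "p = 2 * pi * lambda"
  shows "periodic_solution f p (\<lambda>t. x (t / lambda))" "rescale lambda (\<lambda>t. x (t / lambda)) = x"
proof -
  have chain: "((\<lambda>t. h (t / lambda)) has_vector_derivative (1 / lambda) *\<^sub>R h') (at t)"
    if "(h has_vector_derivative h') (at (t / lambda))" for h :: "real \<Rightarrow> real^4" and h' t
  proof -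
    have "((h \<circ> (\<lambda>t. t / lambda)) has_vector_derivative (1 / lambda) *\<^sub>R h') (at t)"
      by (rule vector_diff_chain_at[where g = h and f = "\<lambda>t. t / lambda", OF _ that])
        (use lambda in \<open>auto intro!: derivative_eq_intros simp flip: has_real_derivative_iff_has_vector_derivative\<close>)
    then show ?thesis by (simp add: o_def)
  qed
  \<comment> \<open>The nonlinear equation is read as the linear problem with c = 1, for which
    derivatives of waves are known to be periodic.\<close>
  have yper: "y (t + 2 * pi) = y t" for t
    by (rule linear_solution_deriv_periodic[where c = 1 and q = "\<lambda>t. x t - lambda\<^sup>2 *\<^sub>R f (x t)", OF _ w])
      (simp add: linear_solution_def x y)
  have shift: "(t + p) / lambda = t / lambda + 2 * pi" for t
    using lambda by (simp add: field_simps)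
  show "periodic_solution f p (\<lambda>t. x (t / lambda))"
    unfolding periodic_solution_def
  proof (intro exI[of _ "\<lambda>t. (1 / lambda) *\<^sub>R y (t / lambda)"] conjI allI)
    fix t
    show "((\<lambda>t. x (t / lambda)) has_vector_derivative (1 / lambda) *\<^sub>R y (t / lambda)) (at t)"
      by (rule chain[OF x])
    have "((\<lambda>t. (1 / lambda) *\<^sub>R y (t / lambda)) has_vector_derivative
        (1 / lambda) *\<^sub>R ((1 / lambda) *\<^sub>R (lambda\<^sup>2 *\<^sub>R f (x (t / lambda))))) (at t)"
      by (rule bounded_linear.has_vector_derivative[OF bounded_linear_scaleR_right chain[OF y]])
    then show "((\<lambda>t. (1 / lambda) *\<^sub>R y (t / lambda)) has_vector_derivative f (x (t / lambda))) (at t)"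
      using lambda by (simp add: power2_eq_square)
    show "x (t / lambda) = x ((t + p) / lambda)" by (simp add: shift wave_periodic[OF w])
    show "(1 / lambda) *\<^sub>R y (t / lambda) = (1 / lambda) *\<^sub>R y ((t + p) / lambda)"
      by (simp add: shift yper)
  qed
  show "rescale lambda (\<lambda>t. x (t / lambda)) = x"
    using lambda by (simp add: rescale_def)
qed

theorem theorem4p1:
  fixes g :: "real \<Rightarrow> real" and f :: "real^4 \<Rightarrow> real^4" and M p lambda :: real
  assumes f_def: "f = network_field g"
    and g_odd: "\<forall>s. g (- s) = - g s"
    and g_C1: "g C1_differentiable_on UNIV"
    and g_deriv0: "deriv g 0 = 0"
    and M_pos: "M > 0"
    and g_growth: "\<forall>s. \<bar>s\<bar> > M \<longrightarrow> \<bar>g s\<bar> > \<bar>s\<bar>"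
    and Nagumo: "\<forall>u. norm u > M \<longrightarrow> inner u (f u) > 0"
    and p_pos: "p > 0"
    and lambda_def: "lambda = p / (2 * pi)"
    and lambda_gt: "lambda > 1 / omega3"
    and nonresonance: "\<forall>k::nat. odd k \<longrightarrow>
          (\<forall>\<omega> \<in> {omega1, omega2, omega3}. lambda \<noteq> real k / \<omega>)"
  shows "(\<exists>u. periodic_solution f p u \<and> \<not> u constant_on UNIV) \<and>
    (\<forall>k::nat.
      \<comment> \<open>(a)\<close>
      (real (2 * k + 1) / omega1 < lambda \<and> lambda < real (2 * k + 3) / omega3 \<longrightarrow>
        (\<exists>u m. periodic_solution f p u \<and>
          isotropy_group (rescale lambda u) = Z2_times_dihedral_d (2 * m + 1))) \<and>
      \<comment> \<open>(b)\<close>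
      (real (2 * k + 1) / omega2 < lambda \<and> lambda < real (2 * k + 1) / omega1 \<longrightarrow>
        (\<exists>u v m m'. periodic_solution f p u \<and> periodic_solution f p v \<and> u \<noteq> v \<and>
          isotropy_group (rescale lambda u) = Z2_times_dihedral_d (2 * m + 1) \<and>
          isotropy_group (rescale lambda v) = V4_amalgam_dihedral (2 * m' + 1))) \<and>
      \<comment> \<open>(c)\<close>
      (real (2 * k + 1) / omega3 < lambda \<and> lambda < real (2 * k + 1) / omega2 \<longrightarrow>
        (\<exists>u v m. periodic_solution f p u \<and> periodic_solution f p v \<and> u \<noteq> v \<and>
          isotropy_group (rescale lambda u) = V4_amalgam_dihedral (2 * m + 1) \<and>
          isotropy_group (rescale lambda v) = V4_amalgam_dihedral (2 * m + 1))))"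
proof -
  have lambda: "lambda > 0" "p = 2 * pi * lambda" using p_pos by (simp_all add: lambda_def)
  have f_odd: "f (- u) = - f u" for u unfolding f_def by (rule network_field_minus[OF g_odd])
  have sqrt2: "sqrt 2 * sqrt 2 = 2" "sqrt 2 > 1" "sqrt 2 < 2" by (simp_all add: real_less_lsqrt)
  have omega: "0 < omega1" "omega1 < omega2" "omega2 < omega3"
    using sqrt2 by (simp_all add: omega1_def omega2_def omega3_def)
  have omega_sq: "omega2\<^sup>2 = 2" "omega3\<^sup>2 = 2 + sqrt 2"
    using sqrt2 by (simp_all add: omega2_def omega3_def)
  have sym: "\<exists>u m x. periodic_solution f p u \<and> rescale lambda u = x \<and> wave xi x \<and> (\<exists>t. x t \<noteq> 0) \<and>
      isotropy_group x = Z2_times_dihedral_d (2 * m + 1)" if gt: "lambda > 1 / omega2"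
  proof -
    \<comment> \<open>A symmetric eigenvector of \<open>Delta_G\<close> for the eigenvalue
      -2.\<close>
    let ?v = "vector [1, - 1, - 1, 1] :: real^4"
    have v: "xi ?v = ?v" "?v \<noteq> 0" by (simp_all add: vec_4_eq_iff xi_nth vector_4)
    have eig: "Delta_G *v ?v = - omega2\<^sup>2 *\<^sub>R ?v"
      by (simp add: vec_4_eq_iff Delta_G_nth omega_sq vector_4)
    obtain x y where x: "\<And>t. (x has_vector_derivative y t) (at t)"
      "\<And>t. (y has_vector_derivative lambda\<^sup>2 *\<^sub>R f (x t)) (at t)" "wave xi x" "\<exists>t. x t \<noteq> 0"
      unfolding f_def
      by (rule network_wave_exists[OF g_odd g_C1 g_deriv0 M_pos Nagumo[unfolded f_def]
            bounded_linear_xi network_field_xi v eig _ gt]) (use omega in auto)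
    have "continuous_on UNIV x"
      using x(1) has_vector_derivative_continuous continuous_at_imp_continuous_on by blast
    then obtain m where "isotropy_group x = Z2_times_dihedral_d (2 * m + 1)"
      using isotropy_group_symmetric x(3,4) by blast
    then show ?thesis using periodic_solution_from_wave[OF x(1,2,3) lambda] x(3,4) by blast
  qed
  \<comment> \<open>An antisymmetric eigenvector belongs to \<open>omega3\<close>, so the standing
    bound \<open>lambda_gt\<close> provides this wave in every case, in particular for the
    non-constant solution.\<close>
  have anti: "\<exists>u m x. periodic_solution f p u \<and> rescale lambda u = x \<and> wave (\<lambda>u. - xi u) x \<and>
      (\<exists>t. x t \<noteq> 0) \<and> isotropy_group x = V4_amalgam_dihedral (2 * m + 1)"
  proof -
    let ?P = "\<lambda>u. - xi u" and ?v = "vector [1, - (1 + sqrt 2), 1 + sqrt 2, - 1] :: real^4"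
    have P: "bounded_linear ?P" by (intro bounded_linear_minus bounded_linear_xi)
    have f_P: "network_field g (?P u) = ?P (network_field g u)" for u
      by (simp add: network_field_minus[OF g_odd] network_field_xi)
    have v: "?P ?v = ?v" "?v \<noteq> 0" by (simp_all add: vec_4_eq_iff xi_nth vector_4)
    have eig: "Delta_G *v ?v = - omega3\<^sup>2 *\<^sub>R ?v"
      using sqrt2(1) by (simp add: vec_4_eq_iff Delta_G_nth omega_sq vector_4 algebra_simps)
    obtain x y where x: "\<And>t. (x has_vector_derivative y t) (at t)"
      "\<And>t. (y has_vector_derivative lambda\<^sup>2 *\<^sub>R f (x t)) (at t)" "wave ?P x" "\<exists>t. x t \<noteq> 0"
      unfolding f_def
      by (rule network_wave_exists[OF g_odd g_C1 g_deriv0 M_pos Nagumo[unfolded f_def]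
            P f_P v eig _ lambda_gt]) (use omega in auto)
    have "continuous_on UNIV x"
      using x(1) has_vector_derivative_continuous continuous_at_imp_continuous_on by blast
    then obtain m where "isotropy_group x = V4_amalgam_dihedral (2 * m + 1)"
      using isotropy_group_antisymmetric x(3,4) by blast
    then show ?thesis using periodic_solution_from_wave[OF x(1,2,3) lambda] x(3,4) by blast
  qed
  obtain v m' z where v: "periodic_solution f p v" "rescale lambda v = z" "wave (\<lambda>u. - xi u) z"
    "\<exists>t. z t \<noteq> 0" "isotropy_group z = V4_amalgam_dihedral (2 * m' + 1)" using anti by blast
  have "\<not> v constant_on UNIV"
  proof
    assume "v constant_on UNIV"
    then obtain c where "\<And>t. v t = c" by (auto simp: constant_on_def)
    then have z: "z t = c" for t using v(2) by (auto simp: rescale_def)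
    then have "c = - c" using v(3) by (auto simp: wave_def)
    then have "c = 0" by (simp add: eq_minus_self_iff)
    then show False using z v(4) by simp
  qed
  \<comment> \<open>The lower bounds in (a) and (b), with \<open>omega1\<close> and
    \<open>omega2\<close> for \<omega>, put lambda in the range where the symmetric wave
    exists.\<close>
  moreover have "1 / omega2 < lambda" if "real (2 * k + 1) / \<omega> < lambda" "0 < \<omega>" "\<omega> \<le> omega2" for k \<omega>
  proof -
    have "1 / omega2 \<le> 1 / \<omega>" using that by (simp add: frac_le)
    also have "\<dots> \<le> real (2 * k + 1) / \<omega>" using that by (simp add: divide_right_mono)
    finally show ?thesis using that by linarith
  qed
  \<comment> \<open>A curve that is both symmetric and antisymmetric is zero; this separates the two
    solutions in (b).\<close>
  moreover have "u \<noteq> v" if u: "wave xi (rescale lambda u)" for u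
  proof
    assume "u = v"
    then have "xi (z t) = z t" "- xi (z t) = z t" for t using u v(2,3) by (auto simp: wave_def)
    then have "z t = - z t" for t by metis
    then show False using v(4) by (simp add: eq_minus_self_iff)
  qed
  \<comment> \<open>The second solution for (c): a change of sign preserves the equation and the
    isotropy group, and it moves \<open>v\<close> because \<open>v\<close> is not zero.\<close>
  moreover have "periodic_solution f p (\<lambda>t. - v t)" by (rule periodic_solution_minus[OF v(1) f_odd])
  moreover have "isotropy_group (rescale lambda (\<lambda>t. - v t)) = V4_amalgam_dihedral (2 * m' + 1)"
    using isotropy_group_minus[of z] v(2,5) by (auto simp: rescale_def)
  moreover have "v \<noteq> (\<lambda>t. - v t)"
  proof
    assume "v = (\<lambda>t. - v t)"
    then have "v t = - v t" for t by metis
    then have "v t = 0" for t by (simp add: eq_minus_self_iff)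
    then show False using v(2,4) by (auto simp: rescale_def)
  qed
  ultimately show ?thesis using sym v omega
    by (intro conjI allI impI) (metis less_imp_le less_trans order_refl)+
qed

end
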